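(* (i) Let $I$ be an interval and let $p_I$ be the associated point of the topos $\hat\Delta$ of simplicial sets. If $p_I$ admits a cyclic structure, then the ordered set $(\mathbb Z\times I)/\sim$ is homogeneous, i.e. its group of order automorphisms acts transitively on it. (ii) There exist points of $\hat\Delta$ (of the form $p_I$, $I$ an interval) that do not admit any cyclic structure. (iii) If $I$ is a finite interval, then $p_I$ has exactly one cyclic structure.
   Context: An interval is a totally ordered set $I$ with a smallest element $b$ and a largest element $t$, $b<t$. The ordered set $(\mathbb Z\times I)/\sim$ is the quotient of $\mathbb Z\times I$, with the lexicographic order ($n>m\Rightarrow(n,u)>(m,v)$; $(n,u)\ge(n,v)\iff u\ge v$), by the identifications $(n,t)\sim(n+1,b)$, $n\in\mathbb Z$. $\Delta$ is the simplicial category: objects $[n]=\{0,\dots,n\}$, $n\ge0$, morphisms the non-decreasing maps. The cyclic category $\Lambda$ has one object $[n]$ for each $n\ge 0$, and $\mathrm{Hom}_\Lambda([n],[m])$ is the set of non-decreasing maps $f:\mathbb Z\to\mathbb Z$ with $f(x+n+1)=f(x)+m+1$ for all $x$, modulo $f\sim f+k(m+1)$, $k\in\mathbb Z$; composition is composition of maps. The inclusion $j:\Delta\hookrightarrow\Lambda$ is the identity on objects and $j(f)(x+k(n+1))=f(x)+k(m+1)$ for $f\in\mathrm{Hom}_\Delta([n],[m])$, $x\in[n]$, $k\in\mathbb Z$. The point $p_I$ of $\hat\Delta=\mathrm{Sets}^{\Delta^{\rm op}}$ is given by the flat covariant functor $\mathcal F_I:\Delta\to\mathrm{Sets}$, where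 $\mathcal F_I([n])$ is the set of non-decreasing sequences $\beta=(\beta_j)_{0\le j\le n+1}$ in $I$ with $\beta_0=b$, $\beta_{n+1}=t$, and for $f\in\mathrm{Hom}_\Delta([n],[m])$, $(f_*\beta)_j=\beta_{f^*(j)}$ with $f^*(j)=\min\{i\in[n]: f(i)\ge j\}$ (and $f^*(j)=n+1$ if there is no such $i$), $0\le j\le m+1$. A cyclic structure on $p_I$ is a functor $\tilde{\mathcal F}:\Lambda\to\mathrm{Sets}$ with $\tilde{\mathcal F}\circ j=\mathcal F_I$. *)

theory Defs
  imports Complex_Main "HOL-Library.FuncSet"
begin

text \<open>Totally ordered sets are subsets of a linearly ordered type, with the induced order. In
  particular \<open>order_interval\<close> does not say that \<open>I\<close> is order-convex in the ambient type.\<close>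

definition order_interval :: "'a::linorder set \<Rightarrow> 'a \<Rightarrow> 'a \<Rightarrow> bool" where
  "order_interval I b t \<longleftrightarrow> b \<in> I \<and> t \<in> I \<and> b < t \<and> (\<forall>x\<in>I. b \<le> x \<and> x \<le> t)"

definition lex_le :: "int \<times> 'a::linorder \<Rightarrow> int \<times> 'a \<Rightarrow> bool" where
  "lex_le x y \<longleftrightarrow> fst x < fst y \<or> fst x = fst y \<and> snd x \<le> snd y"

definition glue_rel :: "'a set \<Rightarrow> 'a \<Rightarrow> 'a \<Rightarrow> (int \<times> 'a) rel" where
  "glue_rel I b t =
    {(x, y). x \<in> UNIV \<times> I \<and> y \<in> UNIV \<times> I \<and>
      (x = y \<or> (\<exists>n. x = (n, t) \<and> y = (n + 1, b)) \<or> (\<exists>n. x = (n + 1, b) \<and> y = (n, t)))}"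

definition glued_line :: "'a set \<Rightarrow> 'a \<Rightarrow> 'a \<Rightarrow> (int \<times> 'a) set set" where
  "glued_line I b t = (UNIV \<times> I) // glue_rel I b t"

text \<open>The classes of \<^const>\<open>glue_rel\<close> are order-convex, so comparing some pair of
  representatives is the induced total order on the quotient.\<close>

definition glued_le :: "(int \<times> 'a::linorder) set \<Rightarrow> (int \<times> 'a) set \<Rightarrow> bool" where
  "glued_le X Y \<longleftrightarrow> (\<exists>x\<in>X. \<exists>y\<in>Y. lex_le x y)"

definition order_automorphism :: "'x set \<Rightarrow> ('x \<Rightarrow> 'x \<Rightarrow> bool) \<Rightarrow> ('x \<Rightarrow> 'x) \<Rightarrow> bool" where
  "order_automorphism X le \<phi> \<longleftrightarrow>
    bij_betw \<phi> X X \<and> (\<forall>x\<in>X. \<forall>y\<in>X. le (\<phi> x) (\<phi> y) \<longleftrightarrow> le x y)"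

definition homogeneous_order :: "'x set \<Rightarrow> ('x \<Rightarrow> 'x \<Rightarrow> bool) \<Rightarrow> bool" where
  "homogeneous_order X le \<longleftrightarrow>
    (\<forall>x\<in>X. \<forall>y\<in>X. \<exists>\<phi>. order_automorphism X le \<phi> \<and> \<phi> x = y)"

text \<open>Both categories have the objects \<open>[n]\<close>, represented by \<open>n\<close>. Maps and functors are
  extensional (\<open>undefined\<close> outside their domain), so that HOL equality is the intended equality.\<close>

definition Delta_hom :: "nat \<Rightarrow> nat \<Rightarrow> (nat \<Rightarrow> nat) set" where
  "Delta_hom n m = {f \<in> {0..n} \<rightarrow>\<^sub>E {0..m}. mono_on {0..n} f}"

definition Lambda_lift :: "nat \<Rightarrow> nat \<Rightarrow> (int \<Rightarrow> int) set" where
  "Lambda_lift n m = {f. mono f \<and> (\<forall>x. f (x + int n + 1) = f x + int m + 1)}"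

definition Lambda_rel :: "nat \<Rightarrow> nat \<Rightarrow> (int \<Rightarrow> int) rel" where
  "Lambda_rel n m =
    {(f, g). f \<in> Lambda_lift n m \<and> g \<in> Lambda_lift n m \<and>
      (\<exists>k. g = (\<lambda>x. f x + k * (int m + 1)))}"

definition Lambda_hom :: "nat \<Rightarrow> nat \<Rightarrow> (int \<Rightarrow> int) set set" where
  "Lambda_hom n m = Lambda_lift n m // Lambda_rel n m"

definition Lambda_id :: "nat \<Rightarrow> (int \<Rightarrow> int) set" where
  "Lambda_id n = Lambda_rel n n `` {id}"

text \<open>The elementwise composite of two classes is exactly the class of the composite of any
  representatives.\<close>

definition Lambda_comp :: "(int \<Rightarrow> int) set \<Rightarrow> (int \<Rightarrow> int) set \<Rightarrow> (int \<Rightarrow> int) set" where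
  "Lambda_comp \<psi> \<phi> = {g \<circ> f | g f. g \<in> \<psi> \<and> f \<in> \<phi>}"

definition j_map :: "nat \<Rightarrow> nat \<Rightarrow> (nat \<Rightarrow> nat) \<Rightarrow> (int \<Rightarrow> int) set" where
  "j_map n m f = Lambda_rel n m ``
    {\<lambda>x. int (f (nat (x mod (int n + 1)))) + (x div (int n + 1)) * (int m + 1)}"

text \<open>Data of a covariant set-valued functor on a category with objects \<open>[n]\<close> and arrows in
  \<open>'h\<close>: \<open>Fmap F n m f\<close> is the image of the arrow \<open>f\<close> from \<open>[n]\<close> to \<open>[m]\<close>.\<close>

record ('h, 'x) set_functor =
  Fobj :: "nat \<Rightarrow> 'x set"
  Fmap :: "nat \<Rightarrow> nat \<Rightarrow> 'h \<Rightarrow> 'x \<Rightarrow> 'x"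

definition Lambda_functor :: "((int \<Rightarrow> int) set, 'x) set_functor \<Rightarrow> bool" where
  "Lambda_functor F \<longleftrightarrow>
    (\<forall>n m. Fmap F n m \<in> Lambda_hom n m \<rightarrow>\<^sub>E (Fobj F n \<rightarrow>\<^sub>E Fobj F m)) \<and>
    (\<forall>n. Fmap F n n (Lambda_id n) = (\<lambda>x\<in>Fobj F n. x)) \<and>
    (\<forall>n m p. \<forall>\<phi>\<in>Lambda_hom n m. \<forall>\<psi>\<in>Lambda_hom m p.
      Fmap F n p (Lambda_comp \<psi> \<phi>) = compose (Fobj F n) (Fmap F m p \<psi>) (Fmap F n m \<phi>))"

definition precomp_j :: "((int \<Rightarrow> int) set, 'x) set_functor \<Rightarrow> (nat \<Rightarrow> nat, 'x) set_functor" where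
  "precomp_j F =
    \<lparr>Fobj = Fobj F, Fmap = (\<lambda>n m. \<lambda>f\<in>Delta_hom n m. Fmap F n m (j_map n m f))\<rparr>"

definition point_obj :: "'a::linorder set \<Rightarrow> 'a \<Rightarrow> 'a \<Rightarrow> nat \<Rightarrow> (nat \<Rightarrow> 'a) set" where
  "point_obj I b t n =
    {\<beta> \<in> {0..n + 1} \<rightarrow>\<^sub>E I. mono_on {0..n + 1} \<beta> \<and> \<beta> 0 = b \<and> \<beta> (n + 1) = t}"

definition upper_star :: "nat \<Rightarrow> (nat \<Rightarrow> nat) \<Rightarrow> nat \<Rightarrow> nat" where
  "upper_star n f j =
    (if \<exists>i\<in>{0..n}. j \<le> f i then Min {i \<in> {0..n}. j \<le> f i} else n + 1)"

text \<open>The point \<open>p\<^sub>I\<close> of the topos of simplicial sets, given by its flat functor on the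
  simplicial category.\<close>

definition point_functor :: "'a::linorder set \<Rightarrow> 'a \<Rightarrow> 'a \<Rightarrow> (nat \<Rightarrow> nat, nat \<Rightarrow> 'a) set_functor" where
  "point_functor I b t =
    \<lparr>Fobj = point_obj I b t,
     Fmap = (\<lambda>n m. \<lambda>f\<in>Delta_hom n m. \<lambda>\<beta>\<in>point_obj I b t n. \<lambda>j\<in>{0..m + 1}. \<beta> (upper_star n f j))\<rparr>"

definition cyclic_structure ::
  "'a::linorder set \<Rightarrow> 'a \<Rightarrow> 'a \<Rightarrow> ((int \<Rightarrow> int) set, nat \<Rightarrow> 'a) set_functor \<Rightarrow> bool" where
  "cyclic_structure I b t F \<longleftrightarrow> Lambda_functor F \<and> precomp_j F = point_functor I b t"

end

theory Submission imports Defs begin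

text \<open>Passing to Galois adjoints turns an arrow \<open>[n] \<rightarrow> [m]\<close> of the cyclic category into a periodic map
  \<open>c\<close> in the other direction, and a simplicial arrow acts on a chain by \<open>\<beta> \<mapsto> \<beta> \<circ> c\<close>. Think of a chain
  as cutting one full turn into successive arcs, an arc being an element of \<open>I\<close> once it is moved to
  start at \<open>b\<close>. A cyclic structure is then determined by two operations on \<open>I\<close>: the arc \<open>fwd x y\<close>
  from \<open>x\<close> to \<open>y \<ge> x\<close>, and the arc \<open>bwd x y\<close> from \<open>x\<close> to the next copy of \<open>y \<le> x\<close>. Invertibility of
  the rotation of \<open>[2]\<close> makes \<open>fwd x\<close> an order isomorphism from \<open>[x, t]\<close> onto an initial segment of
  \<open>I\<close>, with inverse \<open>bwd (fwd x t)\<close>. Together the two operations give an automorphism of the glued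
  line carrying \<open>x\<close> to \<open>b\<close>, whence homogeneity; they rule out \<open>{0} \<union> [1, 2]\<close>, where \<open>0\<close> has an immediate
  successor and \<open>1\<close> has none; and for finite \<open>I\<close> they are determined by counting. Existence for
  finite \<open>I\<close> comes from the action \<open>\<beta> \<mapsto> \<beta> (c j) - \<beta> (c 0)\<close> on chains of integers.\<close>

subsection \<open>Periodic monotone maps and their adjoints\<close>

text \<open>The increment \<open>p\<close> is independent of the period: it is \<open>n + 1\<close>
  for lifts of cyclic arrows and the rank of \<open>t\<close> for chains of ranks.\<close>

definition period_ext :: "nat \<Rightarrow> int \<Rightarrow> (nat \<Rightarrow> int) \<Rightarrow> int \<Rightarrow> int" where
  "period_ext m p g x = g (nat (x mod (int m + 1))) + x div (int m + 1) * p"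

lemma period_ext_of_nat: "k \<le> m \<Longrightarrow> period_ext m p g (int k) = g k"
  by (simp add: period_ext_def)

lemma period_ext_shift: "period_ext m p g (x + int m + 1) = period_ext m p g x + p"
proof -
  have "(x + int m + 1) mod (int m + 1) = x mod (int m + 1)"
    using mod_add_self2[of x "int m + 1"] by (simp add: add.assoc)
  moreover have "(x + int m + 1) div (int m + 1) = x div (int m + 1) + 1"
    using div_add_self2[of "int m + 1" x] by (simp add: add.assoc)
  ultimately show ?thesis by (simp add: period_ext_def algebra_simps)
qed

text \<open>Across periods only the wrap from \<open>m\<close> to \<open>m + 1\<close> matters, and
  the second hypothesis is exactly that inequality.\<close>

lemma mono_period_ext:
  assumes "mono_on {0..m} g" and "g m \<le> g 0 + p"
  shows "mono (period_ext m p g)"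
proof (rule monoI)
  fix x y :: int
  assume "x \<le> y"
  define q where "q = int m + 1"
  have q: "q > 0" by (simp add: q_def)
  define k where "k = nat (x mod q)"
  define l where "l = nat (y mod q)"
  have kl: "k \<le> m" "l \<le> m"
    using q pos_mod_bound[of q x] pos_mod_bound[of q y] by (auto simp: k_def l_def q_def)
  have k: "int k = x mod q" and l: "int l = y mod q" using q by (simp_all add: k_def l_def)
  have g: "g 0 \<le> g l" "g k \<le> g m"
    using kl by (auto intro: mono_onD[OF assms(1)])
  have "g 0 \<le> g m" by (auto intro: mono_onD[OF assms(1)])
  with assms(2) have p: "p \<ge> 0" by simp
  show "period_ext m p g x \<le> period_ext m p g y"
  proof (cases "x div q = y div q")
    case True
    then have "int k \<le> int l" using \<open>x \<le> y\<close> k l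
      by (metis add_le_cancel_left mult_div_mod_eq)
    then have "g k \<le> g l" using kl by (auto intro: mono_onD[OF assms(1)])
    then show ?thesis using True by (simp add: period_ext_def k_def l_def q_def)
  next
    case False
    then have "x div q + 1 \<le> y div q" using zdiv_mono1[OF \<open>x \<le> y\<close> q] by simp
    then have "(x div q + 1) * p \<le> y div q * p" using p by (simp add: mult_right_mono)
    then show ?thesis using g assms(2)
      by (simp add: period_ext_def k_def l_def q_def algebra_simps)
  qed
qed

lemma periodic_shift:
  fixes f :: "int \<Rightarrow> int"
  assumes "\<And>x. f (x + int m + 1) = f x + p"
  shows "f (x + k * (int m + 1)) = f x + k * p"
proof -
  have nat_case: "f (x + int k * (int m + 1)) = f x + int k * p" for k x
  proof (induction k)
    case (Suc k)
    have "f (x + int (Suc k) * (int m + 1)) = f ((x + int k * (int m + 1)) + int m + 1)"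
      by (simp add: algebra_simps)
    also have "\<dots> = f (x + int k * (int m + 1)) + p" by (rule assms)
    finally show ?case using Suc by (simp add: algebra_simps)
  qed simp
  show ?thesis
  proof (cases "k \<ge> 0")
    case True
    then show ?thesis using nat_case[of x "nat k"] by simp
  next
    case False
    then show ?thesis using nat_case[of "x + k * (int m + 1)" "nat (- k)"]
      by (simp add: algebra_simps)
  qed
qed

lemma periodic_eqI:
  fixes f g :: "int \<Rightarrow> int"
  assumes f: "\<And>x. f (x + int m + 1) = f x + p" and g: "\<And>x. g (x + int m + 1) = g x + p"
    and eq: "\<And>k. k \<le> m \<Longrightarrow> f (int k) = g (int k)"
  shows "f = g"
proof
  fix x
  define r where "r = x mod (int m + 1)"
  have "0 \<le> r" "r < int m + 1"
    using pos_mod_bound[of "int m + 1" x] by (simp_all add: r_def)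
  then have "f r = g r" using eq[of "nat r"] by simp
  moreover have "x = r + x div (int m + 1) * (int m + 1)"
    by (simp add: r_def mult.commute)
  ultimately show "f x = g x"
    using periodic_shift[where f = f, OF f, of r "x div (int m + 1)"]
      periodic_shift[where f = g, OF g, of r "x div (int m + 1)"] by metis
qed

lemma Lambda_lift_mono: "f \<in> Lambda_lift n m \<Longrightarrow> x \<le> y \<Longrightarrow> f x \<le> f y"
  by (auto simp: Lambda_lift_def mono_def)

lemma Lambda_lift_shift: "f \<in> Lambda_lift n m \<Longrightarrow> f (x + int n + 1) = f x + (int m + 1)"
  by (auto simp: Lambda_lift_def)

lemma Lambda_lift_shift_mult:
  "f \<in> Lambda_lift n m \<Longrightarrow> f (x + k * (int n + 1)) = f x + k * (int m + 1)"
  by (rule periodic_shift) (rule Lambda_lift_shift)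

lemma Lambda_lift_eqI:
  "\<lbrakk>f \<in> Lambda_lift n m; g \<in> Lambda_lift n m; \<And>k. k \<le> n \<Longrightarrow> f (int k) = g (int k)\<rbrakk> \<Longrightarrow> f = g"
  by (rule periodic_eqI[where m = n]) (auto intro: Lambda_lift_shift)

lemma Lambda_lift_comp:
  "\<lbrakk>f \<in> Lambda_lift n m; g \<in> Lambda_lift m p\<rbrakk> \<Longrightarrow> g \<circ> f \<in> Lambda_lift n p"
  by (auto simp: Lambda_lift_def mono_def add.assoc)

lemma Lambda_lift_id: "id \<in> Lambda_lift n n"
  by (auto simp: Lambda_lift_def mono_def)

lemma Lambda_lift_add: "f \<in> Lambda_lift n m \<Longrightarrow> (\<lambda>x. f x + k) \<in> Lambda_lift n m"
  by (auto simp: Lambda_lift_def mono_def)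

lemma period_ext_Lambda_lift:
  "\<lbrakk>mono_on {0..m} g; g m \<le> g 0 + int n + 1\<rbrakk> \<Longrightarrow> period_ext m (int n + 1) g \<in> Lambda_lift m n"
  using period_ext_shift[of m "int n + 1" g] mono_period_ext[of m g "int n + 1"]
  by (simp add: Lambda_lift_def add.assoc)

section \<open>Periodic maps written as the list of their values over one period\<close>

definition jumps :: "nat \<Rightarrow> int list \<Rightarrow> int \<Rightarrow> int" where
  "jumps n xs = period_ext (length xs - 1) (int n + 1) ((!) xs)"

lemma jumps_Lambda_lift:
  assumes "length xs = m + 1" "sorted xs" "last xs \<le> hd xs + int n + 1"
  shows "jumps n xs \<in> Lambda_lift m n"
proof -
  have "xs \<noteq> []" using assms(1) by auto
  then show ?thesis unfolding jumps_def using assms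
    by (auto simp: mono_on_def sorted_nth_mono last_conv_nth hd_conv_nth
        intro!: period_ext_Lambda_lift)
qed

lemma jumps_of_nat: "k < length xs \<Longrightarrow> jumps n xs (int k) = xs ! k"
  by (simp add: jumps_def period_ext_of_nat)

lemma jumps_shift: "xs \<noteq> [] \<Longrightarrow> jumps n xs (x + int (length xs)) = jumps n xs x + (int n + 1)"
  using period_ext_shift[of "length xs - 1" "int n + 1" "(!) xs" x]
  by (simp add: jumps_def Suc_leI add.assoc)

lemma comp_jumps:
  assumes "c \<in> Lambda_lift m n" "xs \<noteq> []"
  shows "c \<circ> jumps m xs = jumps n (map c xs)"
proof -
  have "nat (x mod int (length xs)) < length xs" for x
    using assms(2) pos_mod_bound[of "int (length xs)" x] by (simp add: nat_less_iff)
  then show ?thesis using assms(2) Lambda_lift_shift_mult[OF assms(1)]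
    by (simp add: jumps_def period_ext_def fun_eq_iff Suc_leI)
qed

section \<open>Galois adjoints of periodic monotone maps\<close>

definition galois :: "(int \<Rightarrow> int) \<Rightarrow> (int \<Rightarrow> int) \<Rightarrow> bool" where
  "galois c f \<longleftrightarrow> (\<forall>i j. c j \<le> i \<longleftrightarrow> j \<le> f i)"

lemma galois_lower_unique: "galois c f \<Longrightarrow> galois d f \<Longrightarrow> c = d"
  unfolding galois_def by (intro ext antisym) blast+

lemma galois_upper_unique: "galois c f \<Longrightarrow> galois c g \<Longrightarrow> f = g"
  unfolding galois_def by (intro ext antisym) blast+

lemma galois_comp: "galois c f \<Longrightarrow> galois d g \<Longrightarrow> galois (c \<circ> d) (g \<circ> f)"
  by (simp add: galois_def)

lemma galois_id: "galois id id"
  by (simp add: galois_def)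

lemma galois_add: "galois c f \<Longrightarrow> galois (\<lambda>x. c (x - k)) (\<lambda>x. f x + k)"
  by (simp add: galois_def algebra_simps)

text \<open>The adjoint at \<open>i\<close> is the largest \<open>j\<close> with
  \<open>c j \<le> i\<close>. It exists because periodicity makes \<open>c\<close> unbounded in both
  directions.\<close>

lemma galois_upper_exists:
  assumes c: "c \<in> Lambda_lift m n"
  shows "\<exists>f\<in>Lambda_lift n m. galois c f"
proof
  define f where "f i = Sup {j. c j \<le> i}" for i
  have bdd: "bdd_above {j. c j \<le> i}" for i
  proof (rule bdd_aboveI)
    fix j assume "j \<in> {j. c j \<le> i}"
    then have j: "c j \<le> i" by simp
    show "j \<le> (\<bar>i\<bar> + \<bar>c 0\<bar> + 1) * (int m + 1)"
    proof (rule ccontr)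
      let ?k = "\<bar>i\<bar> + \<bar>c 0\<bar> + 1"
      assume "\<not> ?thesis"
      then have "c (0 + ?k * (int m + 1)) \<le> c j"
        by (intro Lambda_lift_mono[OF c]) simp
      then have "c 0 + ?k * (int n + 1) \<le> i"
        using Lambda_lift_shift_mult[OF c, of 0 ?k] j by simp
      moreover have "?k * 1 \<le> ?k * (int n + 1)" by (intro mult_left_mono) auto
      ultimately have "c 0 + ?k * 1 \<le> i" by (meson add_left_mono order_trans)
      then show False using abs_ge_self[of i] abs_ge_minus_self[of "c 0"] by simp
    qed
  qed
  have ne: "\<exists>j. c j \<le> i" for i
  proof
    let ?k = "\<bar>i\<bar> + \<bar>c 0\<bar>"
    have "?k * 1 \<le> ?k * (int n + 1)" by (intro mult_left_mono) auto
    then have "c 0 + (- ?k) * (int n + 1) \<le> c 0 - ?k * 1" by (simp only: mult_minus_left)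
    also have "\<dots> \<le> i" using abs_ge_self[of "c 0"] abs_ge_minus_self[of i] by simp
    finally show "c (0 + (- ?k) * (int m + 1)) \<le> i"
      unfolding Lambda_lift_shift_mult[OF c] .
  qed
  have gal: "c j \<le> i \<longleftrightarrow> j \<le> f i" for i j
  proof
    assume "c j \<le> i"
    then show "j \<le> f i" unfolding f_def by (intro cSup_upper bdd) simp
  next
    assume "j \<le> f i"
    \<comment> \<open>Strictness at \<open>j - 1\<close> yields an integer \<open>z \<ge> j\<close>
      in the set, which is as good as attaining the supremum.\<close>
    then have "j - 1 < Sup {j. c j \<le> i}" by (simp add: f_def)
    then obtain z where "c z \<le> i" "j - 1 < z"
      using less_cSupD[of "{j. c j \<le> i}"] ne[of i] by blast
    then show "c j \<le> i" using Lambda_lift_mono[OF c, of j z] by simp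
  qed
  then show "galois c f" by (simp add: galois_def)
  have "f (x + int n + 1) = f x + int m + 1" for x
  proof (rule antisym)
    have "c (f (x + int n + 1)) \<le> x + int n + 1" by (simp add: gal)
    then have "c (f (x + int n + 1) + (-1) * (int m + 1)) \<le> x"
      using Lambda_lift_shift_mult[OF c, of "f (x + int n + 1)" "-1"] by simp
    then show "f (x + int n + 1) \<le> f x + int m + 1" by (simp add: gal)
    have "c (f x) \<le> x" by (simp add: gal)
    then show "f x + int m + 1 \<le> f (x + int n + 1)"
      using Lambda_lift_shift[OF c, of "f x"] by (simp flip: gal)
  qed
  moreover have "mono f"
    by (rule monoI) (meson gal order_refl order_trans)
  ultimately show "f \<in> Lambda_lift n m" by (simp add: Lambda_lift_def)
qed

text \<open>The reflection taking \<open>h\<close> to \<open>\<lambda>x. - h (- x)\<close> reverses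
  the order and so exchanges lower and upper adjoints.\<close>

lemma galois_lower_exists:
  assumes f: "f \<in> Lambda_lift n m"
  shows "\<exists>c\<in>Lambda_lift m n. galois c f"
proof -
  have neg: "(\<lambda>x. - h (- x)) \<in> Lambda_lift k l" if "h \<in> Lambda_lift k l" for h k l
  proof -
    have "h (- (x + int k + 1)) = h (- x) - (int l + 1)" for x
      using Lambda_lift_shift[OF that, of "- (x + int k + 1)"] by simp
    then show ?thesis using that by (auto simp: Lambda_lift_def mono_def)
  qed
  obtain g where g: "g \<in> Lambda_lift m n" "galois (\<lambda>x. - f (- x)) g"
    using galois_upper_exists[OF neg[OF f]] by blast
  have "galois (\<lambda>x. - g (- x)) f"
    using g(2) unfolding galois_def by (metis minus_le_iff neg_le_iff_le minus_minus)
  then show ?thesis using neg[OF g(1)] by blast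
qed

definition upper_adj :: "(int \<Rightarrow> int) \<Rightarrow> int \<Rightarrow> int" where
  "upper_adj c = (THE f. galois c f)"

definition lower_adj :: "(int \<Rightarrow> int) \<Rightarrow> int \<Rightarrow> int" where
  "lower_adj f = (THE c. galois c f)"

lemma upper_adj_eqI: "galois c f \<Longrightarrow> upper_adj c = f"
  unfolding upper_adj_def using galois_upper_unique by blast

lemma lower_adj_eqI: "galois c f \<Longrightarrow> lower_adj f = c"
  unfolding lower_adj_def using galois_lower_unique by blast

lemma upper_adj:
  "c \<in> Lambda_lift m n \<Longrightarrow> upper_adj c \<in> Lambda_lift n m \<and> galois c (upper_adj c)"
  using galois_upper_exists upper_adj_eqI by metis

lemma lower_adj:
  "f \<in> Lambda_lift n m \<Longrightarrow> lower_adj f \<in> Lambda_lift m n \<and> galois (lower_adj f) f"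
  using galois_lower_exists lower_adj_eqI by metis

lemma upper_adj_comp:
  "\<lbrakk>c \<in> Lambda_lift m n; d \<in> Lambda_lift p m\<rbrakk> \<Longrightarrow> upper_adj (c \<circ> d) = upper_adj d \<circ> upper_adj c"
  by (intro upper_adj_eqI galois_comp) (use upper_adj in blast)+

lemma lower_adj_comp:
  "\<lbrakk>f \<in> Lambda_lift n m; g \<in> Lambda_lift m p\<rbrakk> \<Longrightarrow> lower_adj (g \<circ> f) = lower_adj f \<circ> lower_adj g"
  by (intro lower_adj_eqI galois_comp) (use lower_adj in blast)+

lemma upper_adj_lower_adj: "f \<in> Lambda_lift n m \<Longrightarrow> upper_adj (lower_adj f) = f"
  using lower_adj upper_adj_eqI by blast

subsection \<open>Arrows of the two categories\<close>

abbreviation Lambda_class :: "nat \<Rightarrow> nat \<Rightarrow> (int \<Rightarrow> int) \<Rightarrow> (int \<Rightarrow> int) set" where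
  "Lambda_class n m f \<equiv> Lambda_rel n m `` {f}"

lemma equiv_Lambda_rel: "equiv (Lambda_lift n m) (Lambda_rel n m)"
proof (rule equivI)
  show "refl_on (Lambda_lift n m) (Lambda_rel n m)"
    by (auto simp: refl_on_def Lambda_rel_def intro: exI[of _ 0])
  show "sym (Lambda_rel n m)"
  proof (rule symI)
    fix f g assume "(f, g) \<in> Lambda_rel n m"
    then obtain k where "f \<in> Lambda_lift n m" "g \<in> Lambda_lift n m"
      "g = (\<lambda>x. f x + k * (int m + 1))" by (auto simp: Lambda_rel_def)
    then show "(g, f) \<in> Lambda_rel n m"
      by (auto simp: Lambda_rel_def intro!: exI[of _ "- k"])
  qed
  show "trans (Lambda_rel n m)"
  proof (rule transI)
    fix f g h assume "(f, g) \<in> Lambda_rel n m" "(g, h) \<in> Lambda_rel n m"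
    then obtain k l where "f \<in> Lambda_lift n m" "h \<in> Lambda_lift n m"
      "g = (\<lambda>x. f x + k * (int m + 1))" "h = (\<lambda>x. g x + l * (int m + 1))"
      by (auto simp: Lambda_rel_def)
    then show "(f, h) \<in> Lambda_rel n m"
      by (auto simp: Lambda_rel_def algebra_simps intro!: exI[of _ "k + l"])
  qed
qed (auto simp: Lambda_rel_def)

lemma Lambda_class_iff:
  "f \<in> Lambda_lift n m \<Longrightarrow> g \<in> Lambda_class n m f \<longleftrightarrow> (\<exists>k. g = (\<lambda>x. f x + k * (int m + 1)))"
  by (auto simp: Lambda_rel_def intro: Lambda_lift_add)

lemma Lambda_class_add:
  assumes "f \<in> Lambda_lift n m"
  shows "Lambda_class n m (\<lambda>x. f x + k * (int m + 1)) = Lambda_class n m f"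
proof -
  have "(f, \<lambda>x. f x + k * (int m + 1)) \<in> Lambda_rel n m"
    using Lambda_class_iff[OF assms] by blast
  then show ?thesis using equiv_class_eq[OF equiv_Lambda_rel] by metis
qed

lemma Lambda_class_in_hom: "f \<in> Lambda_lift n m \<Longrightarrow> Lambda_class n m f \<in> Lambda_hom n m"
  by (simp add: Lambda_hom_def quotientI)

lemma Lambda_hom_cases:
  assumes "\<phi> \<in> Lambda_hom n m"
  obtains f where "f \<in> Lambda_lift n m" "\<phi> = Lambda_class n m f"
  using assms unfolding Lambda_hom_def by (rule quotientE)

text \<open>A shift of \<open>f\<close> by \<open>l\<close> full turns passes through
  \<open>g\<close> as a shift by \<open>l\<close> full turns of the target, so the two shifts merge
  into one; conversely the whole shift can be placed on the outer factor.\<close>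

lemma Lambda_comp_class:
  assumes f: "f \<in> Lambda_lift n m" and g: "g \<in> Lambda_lift m p"
  shows "Lambda_comp (Lambda_class m p g) (Lambda_class n m f) = Lambda_class n p (g \<circ> f)"
proof (intro equalityI subsetI)
  fix h assume "h \<in> Lambda_comp (Lambda_class m p g) (Lambda_class n m f)"
  then obtain g' f' where h: "h = g' \<circ> f'"
    and "g' \<in> Lambda_class m p g" "f' \<in> Lambda_class n m f"
    unfolding Lambda_comp_def by blast
  then obtain k l where "g' = (\<lambda>x. g x + k * (int p + 1))" "f' = (\<lambda>x. f x + l * (int m + 1))"
    using Lambda_class_iff f g by metis
  then have "h = (\<lambda>x. (g \<circ> f) x + (k + l) * (int p + 1))"
    unfolding h using Lambda_lift_shift_mult[OF g]
    by (simp add: fun_eq_iff) (simp add: algebra_simps)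
  then show "h \<in> Lambda_class n p (g \<circ> f)"
    using Lambda_class_iff[OF Lambda_lift_comp[OF f g]] by blast
next
  fix h assume "h \<in> Lambda_class n p (g \<circ> f)"
  then obtain k where "h = (\<lambda>x. (g \<circ> f) x + k * (int p + 1))"
    using Lambda_class_iff[OF Lambda_lift_comp[OF f g]] by blast
  then have "h = (\<lambda>x. g x + k * (int p + 1)) \<circ> f" by auto
  moreover have "(\<lambda>x. g x + k * (int p + 1)) \<in> Lambda_class m p g"
    using Lambda_class_iff[OF g] by blast
  moreover have "f \<in> Lambda_class n m f"
    using f equiv_class_self[OF equiv_Lambda_rel] by blast
  ultimately show "h \<in> Lambda_comp (Lambda_class m p g) (Lambda_class n m f)"
    unfolding Lambda_comp_def by blast
qed

section \<open>Simplicial arrows as dual maps fixing 0\<close>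

definition Delta_lift :: "nat \<Rightarrow> nat \<Rightarrow> (nat \<Rightarrow> nat) \<Rightarrow> int \<Rightarrow> int" where
  "Delta_lift n m f = period_ext n (int m + 1) (\<lambda>k. int (f k))"

lemma j_map_eq: "j_map n m f = Lambda_class n m (Delta_lift n m f)"
  by (simp add: j_map_def Delta_lift_def period_ext_def[abs_def])

lemma Delta_hom_le: "f \<in> Delta_hom n m \<Longrightarrow> k \<le> n \<Longrightarrow> f k \<le> m"
  by (auto simp: Delta_hom_def PiE_def Pi_def)

lemma Delta_lift: "f \<in> Delta_hom n m \<Longrightarrow> Delta_lift n m f \<in> Lambda_lift n m"
  unfolding Delta_lift_def using Delta_hom_le[of f n m n]
  by (intro period_ext_Lambda_lift) (auto simp: Delta_hom_def mono_on_def)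

text \<open>The minimum in \<open>upper_star\<close> is the one that computes a lower adjoint; the
  default \<open>n + 1\<close> is the value of the periodic adjoint when no \<open>i \<le> n\<close>
  qualifies.\<close>

lemma lower_adj_Delta_lift:
  assumes f: "f \<in> Delta_hom n m"
  shows lower_adj_Delta_lift_0: "lower_adj (Delta_lift n m f) 0 = 0"
    and lower_adj_Delta_lift_of_nat:
      "j \<le> m + 1 \<Longrightarrow> lower_adj (Delta_lift n m f) (int j) = int (upper_star n f j)"
proof -
  define g where "g = Delta_lift n m f"
  define c where "c = lower_adj g"
  have g: "g \<in> Lambda_lift n m" using Delta_lift[OF f] by (simp add: g_def)
  have c: "c \<in> Lambda_lift m n" and gal: "\<And>i j. c j \<le> i \<longleftrightarrow> j \<le> g i"
    using lower_adj[OF g] by (auto simp: c_def galois_def)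
  have g_nat: "g (int k) = int (f k)" if "k \<le> n" for k
    using that by (simp add: g_def Delta_lift_def period_ext_of_nat)
  have "c 0 \<le> 0" using g_nat[of 0] by (simp add: gal)
  \<comment> \<open>One period back, \<open>g (-1) = f n - (m + 1)\<close>, so the adjoint at 0
    cannot drop below 0.\<close>
  moreover have "g (-1) < 0"
    using Lambda_lift_shift[OF g, of "-1"] g_nat[of n] Delta_hom_le[OF f, of n] by simp
  then have "\<not> c 0 \<le> -1" by (simp add: gal)
  ultimately have c0: "c 0 = 0" by simp
  then show "lower_adj (Delta_lift n m f) 0 = 0" by (simp add: c_def g_def)
  assume j: "j \<le> m + 1"
  define u where "u = upper_star n f j"
  have "int j \<le> g (int u) \<and> u \<le> n + 1"
  proof (cases "\<exists>i\<in>{0..n}. j \<le> f i")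
    case True
    then have u: "u = Min {i \<in> {0..n}. j \<le> f i}" by (simp add: u_def upper_star_def)
    have "u \<in> {i \<in> {0..n}. j \<le> f i}" unfolding u by (rule Min_in) (use True in auto)
    then show ?thesis by (simp add: g_nat)
  next
    case False
    then have "u = n + 1" by (auto simp: u_def upper_star_def)
    \<comment> \<open>At the default, \<open>g (n + 1) = f 0 + m + 1 \<ge> j\<close>; here
      \<open>j \<le> m + 1\<close> enters.\<close>
    then show ?thesis using Lambda_lift_shift[OF g, of 0] g_nat[of 0] j by (simp add: add.commute)
  qed
  then have le: "c (int j) \<le> int u" and u: "u \<le> n + 1" by (auto simp: gal)
  have "int u \<le> c (int j)"
  proof (cases "c (int j) \<le> int n")
    case True
    define i where "i = nat (c (int j))"
    have "0 \<le> c (int j)" using Lambda_lift_mono[OF c, of 0 "int j"] c0 by simp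
    then have i: "int i = c (int j)" "i \<le> n" using True by (auto simp: i_def)
    have "int j \<le> g (int i)" unfolding i(1) by (simp flip: gal)
    then have "j \<le> f i" using g_nat[OF i(2)] by simp
    then have "\<exists>i\<in>{0..n}. j \<le> f i" using i(2) by auto
    then have "u = Min {i \<in> {0..n}. j \<le> f i}" by (simp add: u_def upper_star_def)
    also have "\<dots> \<le> i" using \<open>j \<le> f i\<close> i(2) by (intro Min_le) auto
    finally show ?thesis using i(1) by linarith
  next
    case False
    then show ?thesis using u by linarith
  qed
  then show "lower_adj (Delta_lift n m f) (int j) = int (upper_star n f j)"
    using le by (simp add: c_def g_def u_def)
qed

text \<open>From \<open>c 0 = 0\<close> follows \<open>c (m + 1) = n + 1\<close>, and these two
  values force the upper adjoint to carry \<open>{0..n}\<close> into \<open>{0..m}\<close>.\<close>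

lemma upper_adj_is_Delta_lift:
  assumes c: "c \<in> Lambda_lift m n" and c0: "c 0 = 0"
  shows "\<exists>f\<in>Delta_hom n m. upper_adj c = Delta_lift n m f \<and>
    (\<forall>j\<le>m + 1. upper_star n f j = nat (c (int j)))"
proof
  define g where "g = upper_adj c"
  have g: "g \<in> Lambda_lift n m" and gal: "galois c g"
    using upper_adj[OF c] by (auto simp: g_def)
  have gal': "\<And>i j. c j \<le> i \<longleftrightarrow> j \<le> g i" using gal by (simp add: galois_def)
  define f where "f = restrict (\<lambda>i. nat (g (int i))) {0..n}"
  have pos: "0 \<le> g (int k)" for k
    using c0 by (simp flip: gal')
  have "c (int m + 1) = int n + 1" using Lambda_lift_shift[OF c, of 0] c0 by simp
  then have bound: "g (int k) \<le> int m" if "k \<le> n" for k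
    using that gal'[of "int m + 1" "int k"] by linarith
  show f: "f \<in> Delta_hom n m"
    using bound pos unfolding Delta_hom_def f_def
    by (auto simp: mono_on_def nat_le_iff intro!: nat_mono Lambda_lift_mono[OF g])
  have eq: "g = Delta_lift n m f"
  proof (rule Lambda_lift_eqI[OF g Delta_lift[OF f]])
    fix k assume "k \<le> n"
    then show "g (int k) = Delta_lift n m f (int k)"
      using pos[of k] by (simp add: Delta_lift_def period_ext_of_nat f_def)
  qed
  have "lower_adj (Delta_lift n m f) = c"
    using lower_adj_eqI[OF gal] eq by simp
  then have "upper_star n f j = nat (c (int j))" if "j \<le> m + 1" for j
    using lower_adj_Delta_lift_of_nat[OF f that] by simp
  then show "upper_adj c = Delta_lift n m f \<and> (\<forall>j\<le>m + 1. upper_star n f j = nat (c (int j)))"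
    using eq by (simp add: g_def)
qed

subsection \<open>The arc operations of a cyclic structure\<close>

lemma point_obj_eqI:
  "\<lbrakk>\<beta> \<in> point_obj I b t n; \<gamma> \<in> point_obj I b t n; \<And>j. j \<le> n + 1 \<Longrightarrow> \<beta> j = \<gamma> j\<rbrakk> \<Longrightarrow> \<beta> = \<gamma>"
  unfolding point_obj_def by (auto intro!: PiE_ext[of \<beta> "{0..Suc n}" "\<lambda>_. I" \<gamma>])

lemma point_obj_mono: "\<lbrakk>\<beta> \<in> point_obj I b t n; i \<le> j; j \<le> n + 1\<rbrakk> \<Longrightarrow> \<beta> i \<le> \<beta> j"
  by (auto simp: point_obj_def mono_on_def)

lemma point_obj_in: "\<lbrakk>\<beta> \<in> point_obj I b t n; j \<le> n + 1\<rbrakk> \<Longrightarrow> \<beta> j \<in> I"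
  by (auto simp: point_obj_def PiE_def Pi_def)

lemma point_obj_ends: "\<beta> \<in> point_obj I b t n \<Longrightarrow> \<beta> 0 = b \<and> \<beta> (n + 1) = t"
  by (auto simp: point_obj_def)

section \<open>The action of a cyclic structure, indexed by dual maps\<close>

locale cyclic_point =
  fixes I :: "'a::linorder set" and b t and F :: "((int \<Rightarrow> int) set, nat \<Rightarrow> 'a) set_functor"
  assumes interval: "order_interval I b t" and cyclic: "cyclic_structure I b t F"
begin

abbreviation Pt :: "nat \<Rightarrow> (nat \<Rightarrow> 'a) set" where
  "Pt \<equiv> point_obj I b t"

lemma Fobj_eq: "Fobj F = Pt"
proof -
  have "Fobj (precomp_j F) = Fobj (point_functor I b t)" using cyclic by (simp add: cyclic_structure_def)
  then show ?thesis by (simp add: precomp_j_def point_functor_def)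
qed

lemma Fmap_Delta:
  assumes "f \<in> Delta_hom n m" "\<beta> \<in> Pt n" "j \<le> m + 1"
  shows "Fmap F n m (j_map n m f) \<beta> j = \<beta> (upper_star n f j)"
proof -
  have "Fmap (precomp_j F) n m f \<beta> j = Fmap (point_functor I b t) n m f \<beta> j"
    using cyclic by (simp add: cyclic_structure_def)
  then show ?thesis using assms by (simp add: precomp_j_def point_functor_def)
qed

text \<open>The arrow is entered through its lower adjoint \<open>c\<close>, which names positions
  in the chain; composition therefore reverses.\<close>

definition act :: "nat \<Rightarrow> nat \<Rightarrow> (int \<Rightarrow> int) \<Rightarrow> (nat \<Rightarrow> 'a) \<Rightarrow> nat \<Rightarrow> 'a" where
  "act n m c = Fmap F n m (Lambda_class n m (upper_adj c))"

lemma act_in: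
  assumes "c \<in> Lambda_lift m n" "\<beta> \<in> Pt n" shows "act n m c \<beta> \<in> Pt m"
proof -
  have "Lambda_class n m (upper_adj c) \<in> Lambda_hom n m"
    using upper_adj[OF assms(1)] by (simp add: Lambda_class_in_hom)
  moreover have "Fmap F n m \<in> Lambda_hom n m \<rightarrow>\<^sub>E (Pt n \<rightarrow>\<^sub>E Pt m)"
    using cyclic Fobj_eq by (simp add: cyclic_structure_def Lambda_functor_def)
  ultimately show ?thesis using assms(2) unfolding act_def by blast
qed

lemma act_comp:
  assumes c: "c \<in> Lambda_lift m n" and d: "d \<in> Lambda_lift p m" and \<beta>: "\<beta> \<in> Pt n"
  shows "act n p (c \<circ> d) \<beta> = act m p d (act n m c \<beta>)"
proof -
  let ?f = "upper_adj c" and ?g = "upper_adj d"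
  have fg: "?f \<in> Lambda_lift n m" "?g \<in> Lambda_lift m p" using upper_adj c d by blast+
  have "\<forall>\<phi>\<in>Lambda_hom n m. \<forall>\<psi>\<in>Lambda_hom m p.
      Fmap F n p (Lambda_comp \<psi> \<phi>) = compose (Pt n) (Fmap F m p \<psi>) (Fmap F n m \<phi>)"
    using cyclic Fobj_eq by (simp add: cyclic_structure_def Lambda_functor_def)
  then have "Fmap F n p (Lambda_comp (Lambda_class m p ?g) (Lambda_class n m ?f)) =
      compose (Pt n) (Fmap F m p (Lambda_class m p ?g)) (Fmap F n m (Lambda_class n m ?f))"
    using Lambda_class_in_hom fg by blast
  then show ?thesis
    using \<beta> by (simp add: act_def Lambda_comp_class[OF fg] upper_adj_comp[OF c d] compose_def)
qed

text \<open>Shifting \<open>c\<close> by \<open>k\<close> full turns shifts its upper adjoint by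
  \<open>- k\<close> full turns, which is invisible in \<open>Lambda_hom\<close>.\<close>

lemma act_shift:
  assumes c: "c \<in> Lambda_lift m n"
  shows "act n m (\<lambda>x. c x + k * (int n + 1)) = act n m c"
proof -
  let ?f = "upper_adj c"
  have f: "?f \<in> Lambda_lift n m" "galois c ?f" using upper_adj[OF c] by auto
  have "galois (\<lambda>x. c x + k * (int n + 1)) (\<lambda>x. ?f x + (- k) * (int m + 1))"
    using f(2) Lambda_lift_shift_mult[OF f(1), of _ "- k"]
    by (auto simp: galois_def le_diff_eq[symmetric])
  then have "upper_adj (\<lambda>x. c x + k * (int n + 1)) = (\<lambda>x. ?f x + (- k) * (int m + 1))"
    by (rule upper_adj_eqI)
  then show ?thesis by (simp only: act_def Lambda_class_add[OF f(1)])
qed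

text \<open>Such a \<open>c\<close> comes from a simplicial arrow by
  \<open>upper_adj_is_Delta_lift\<close>, and there the restriction along \<open>j\<close>
  prescribes the action.\<close>

lemma act_Delta:
  assumes "c \<in> Lambda_lift m n" "c 0 = 0" "\<beta> \<in> Pt n" "j \<le> m + 1"
  shows "act n m c \<beta> j = \<beta> (nat (c (int j)))"
  using upper_adj_is_Delta_lift[OF assms(1,2)] Fmap_Delta assms(3,4)
  unfolding act_def by (metis j_map_eq)

lemma act_id: "\<beta> \<in> Pt n \<Longrightarrow> act n n id \<beta> = \<beta>"
  by (rule point_obj_eqI[of _ I b t n])
    (auto intro!: act_in[of id, simplified] simp: Lambda_lift_id act_Delta)

section \<open>Chains given by their interior points, and the two arcs\<close>

definition chain :: "'a list \<Rightarrow> nat \<Rightarrow> 'a" where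
  "chain xs = restrict ((!) (b # xs @ [t])) {0..length xs + 1}"

lemma in_interval: "b \<in> I" "t \<in> I" "b < t" "x \<in> I \<Longrightarrow> b \<le> x" "x \<in> I \<Longrightarrow> x \<le> t"
  using interval by (auto simp: order_interval_def)

lemma chain_in:
  assumes "sorted xs" "set xs \<subseteq> I" "length xs = n" shows "chain xs \<in> Pt n"
proof -
  let ?ys = "b # xs @ [t]"
  have "sorted ?ys" using assms in_interval by (auto simp: sorted_append)
  then have "mono_on {0..n + 1} (chain xs)"
    using assms(3) by (auto simp: mono_on_def chain_def intro!: sorted_nth_mono)
  moreover have "set ?ys \<subseteq> I" using assms in_interval by auto
  then have "?ys ! i \<in> I" if "i \<le> n + 1" for i
    using that assms(3) by (metis add.commute in_mono le_imp_less_Suc length_Cons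
        length_append_singleton nth_mem plus_1_eq_Suc)
  ultimately show ?thesis using assms(3)
    by (auto simp: point_obj_def chain_def nth_append)
qed

lemma chain_nth: "i \<le> length xs + 1 \<Longrightarrow> chain xs i = (b # xs @ [t]) ! i"
  by (simp add: chain_def)

text \<open>The chain \<open>b, x, y, t\<close> has positions 0 to 3. The dual map puts the origin
  at position 1 and the next cut at position 2.\<close>

definition fwd :: "'a \<Rightarrow> 'a \<Rightarrow> 'a" where
  "fwd x y = act 2 1 (jumps 2 [1, 2]) (chain [x, y]) 1"

text \<open>Here \<open>y\<close> is at position 1 and \<open>x\<close> at position 2. A full turn
  has length 3, so position 4 is the next copy of \<open>y\<close>.\<close>

definition bwd :: "'a \<Rightarrow> 'a \<Rightarrow> 'a" where
  "bwd x y = act 2 1 (jumps 2 [2, 4]) (chain [y, x]) 1"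

text \<open>Entry \<open>j\<close> depends only on the positions \<open>c 0\<close> and
  \<open>c j\<close>. Restricting to \<open>[1]\<close> and coarsening the chain to two interior
  points are both simplicial; what remains between \<open>[2]\<close> and \<open>[1]\<close> is one
  of the two defining arcs.\<close>

lemma act_eq:
  assumes \<beta>: "\<beta> \<in> Pt n" and c: "c \<in> Lambda_lift m n" and c0: "0 \<le> c 0" "c 0 \<le> int n + 1"
    and j: "j \<le> m + 1"
  shows "act n m c \<beta> j =
    (if c (int j) \<le> int n + 1 then fwd (\<beta> (nat (c 0))) (\<beta> (nat (c (int j))))
     else bwd (\<beta> (nat (c 0))) (\<beta> (nat (c (int j) - int n - 1))))"
proof -
  have cj: "c 0 \<le> c (int j)" "c (int j) \<le> c 0 + int n + 1"
    using Lambda_lift_mono[OF c, of 0 "int j"] Lambda_lift_mono[OF c, of "int j" "int m + 1"]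
      Lambda_lift_shift[OF c, of 0] j by auto
  \<comment> \<open>This map fixes 0, so it acts by reindexing and extracts entry
    \<open>j\<close>.\<close>
  have J: "jumps m [0, int j] \<in> Lambda_lift 1 m"
    using j by (intro jumps_Lambda_lift) auto
  have "act n m c \<beta> j = act m 1 (jumps m [0, int j]) (act n m c \<beta>) 1"
    using act_Delta[OF J _ act_in[OF c \<beta>], of 1] jumps_of_nat[of 0 "[0, int j]" m]
      jumps_of_nat[of 1 "[0, int j]" m] by simp
  also have "\<dots> = act n 1 (c \<circ> jumps m [0, int j]) \<beta> 1"
    using act_comp[OF c J \<beta>] by simp
  also have "c \<circ> jumps m [0, int j] = jumps n [c 0, c (int j)]"
    using comp_jumps[OF c, of "[0, int j]"] by simp
  finally have eq: "act n m c \<beta> j = act n 1 (jumps n [c 0, c (int j)]) \<beta> 1" .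
  \<comment> \<open>Coarsening: \<open>jumps n [0, u, v]\<close> fixes 0 and reduces
    \<open>\<beta>\<close> to its points at positions \<open>u\<close> and \<open>v\<close>.\<close>
  have via2: "act n 1 (jumps n (map (jumps n [0, u, v]) xs)) \<beta> 1 =
      act 2 1 (jumps 2 xs) (chain [\<beta> (nat u), \<beta> (nat v)]) 1"
    if uv: "0 \<le> u" "u \<le> v" "v \<le> int n + 1" and xs: "jumps 2 xs \<in> Lambda_lift 1 2" "xs \<noteq> []" for u v xs
  proof -
    let ?K = "jumps n [0, u, v]"
    have K: "?K \<in> Lambda_lift 2 n" using uv by (intro jumps_Lambda_lift) auto
    have "act n 2 ?K \<beta> = chain [\<beta> (nat u), \<beta> (nat v)]"
    proof (rule point_obj_eqI[OF act_in[OF K \<beta>]])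
      show "chain [\<beta> (nat u), \<beta> (nat v)] \<in> Pt 2"
        using uv by (intro chain_in) (auto intro!: point_obj_mono[OF \<beta>] point_obj_in[OF \<beta>])
      fix k :: nat assume k: "k \<le> 2 + 1"
      have "?K 0 = 0" using jumps_of_nat[of 0 "[0, u, v]" n] by simp
      moreover have "?K 1 = u" "?K 2 = v" "?K 3 = int n + 1"
        using jumps_of_nat[of 1 "[0, u, v]" n] jumps_of_nat[of 2 "[0, u, v]" n]
          jumps_shift[of "[0, u, v]" n 0] \<open>?K 0 = 0\<close> by simp_all
      moreover have "k = 0 \<or> k = 1 \<or> k = 2 \<or> k = 3" using k by auto
      ultimately show "act n 2 ?K \<beta> k = chain [\<beta> (nat u), \<beta> (nat v)] k"
        using act_Delta[OF K _ \<beta> k] point_obj_ends[OF \<beta>]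
        by - (elim disjE, simp_all add: chain_nth nat_add_distrib)
    qed
    then show ?thesis using act_comp[OF K xs(1) \<beta>] comp_jumps[OF K xs(2)] by simp
  qed
  show ?thesis
  proof (cases "c (int j) \<le> int n + 1")
    case True
    let ?K = "jumps n [0, c 0, c (int j)]"
    have "?K 1 = c 0" "?K 2 = c (int j)"
      using jumps_of_nat[of 1 "[0, c 0, c (int j)]" n] jumps_of_nat[of 2 "[0, c 0, c (int j)]" n] by simp_all
    moreover have "jumps 2 [1, 2] \<in> Lambda_lift 1 2" by (intro jumps_Lambda_lift) auto
    ultimately show ?thesis
      using via2[of "c 0" "c (int j)" "[1, 2]"] True c0 cj eq by (simp add: fwd_def)
  next
    case False
    \<comment> \<open>The second cut lies in the next turn. Its copy \<open>a\<close> one turn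
      earlier satisfies \<open>a \<le> c 0\<close>, since \<open>c\<close> advances by at most one
      turn up to \<open>m + 1\<close>.\<close>
    define a where "a = c (int j) - int n - 1"
    let ?K = "jumps n [0, a, c 0]"
    have "?K 1 = a" "?K 2 = c 0"
      using jumps_of_nat[of 1 "[0, a, c 0]" n] jumps_of_nat[of 2 "[0, a, c 0]" n] by simp_all
    moreover have "?K 4 = a + (int n + 1)"
      using jumps_shift[of "[0, a, c 0]" n 1] \<open>?K 1 = a\<close> by simp
    moreover have "jumps 2 [2, 4] \<in> Lambda_lift 1 2" by (intro jumps_Lambda_lift) auto
    ultimately show ?thesis
      using via2[of a "c 0" "[2, 4]"] False c0 cj eq by (simp add: bwd_def a_def)
  qed
qed

section \<open>Rotations and the inversion of arcs\<close>

lemma shift_Lambda_lift: "(\<lambda>x. x + k) \<in> Lambda_lift n n"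
  by (auto simp: Lambda_lift_def mono_def)

lemma act_full_turn:
  assumes "\<beta> \<in> Pt n" shows "act n n (\<lambda>x. x + (int n + 1)) \<beta> = \<beta>"
  using act_shift[OF Lambda_lift_id[of n], of 1] act_id[OF assms] by simp

text \<open>Source of all inversion formulas for arcs: a rotation is undone by the complementary
  one.\<close>

lemma act_shift_inverse:
  assumes "\<beta> \<in> Pt n" "k + l = int n + 1"
  shows "act n n (\<lambda>x. x + k) (act n n (\<lambda>x. x + l) \<beta>) = \<beta>"
  using act_comp[OF shift_Lambda_lift[of l n] shift_Lambda_lift[of k n] assms(1)]
    act_full_turn[OF assms(1)] assms(2) by (simp add: comp_def add.assoc)

text \<open>Both arcs are consecutive entries of one chain, obtained from
  \<open>b, x, y, z, t\<close> by taking \<open>x\<close> as origin.\<close>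

lemma fwd_mono:
  assumes "x \<in> I" "y \<in> I" "z \<in> I" "x \<le> y" "y \<le> z"
  shows "fwd x y \<le> fwd x z" "fwd x y \<in> I"
proof -
  let ?c = "jumps 3 [1, 2, 3]"
  have c: "?c \<in> Lambda_lift 2 3" by (intro jumps_Lambda_lift) auto
  have \<beta>: "chain [x, y, z] \<in> Pt 3" using assms by (intro chain_in) auto
  have "?c 0 = 1" "?c 1 = 2" "?c 2 = 3"
    using jumps_of_nat[of 0 "[1, 2, 3]" 3] jumps_of_nat[of 1 "[1, 2, 3]" 3]
      jumps_of_nat[of 2 "[1, 2, 3]" 3] by simp_all
  then have "act 3 2 ?c (chain [x, y, z]) 1 = fwd x y" "act 3 2 ?c (chain [x, y, z]) 2 = fwd x z"
    using act_eq[OF \<beta> c, of 1] act_eq[OF \<beta> c, of 2] by (simp_all add: chain_nth)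
  then show "fwd x y \<le> fwd x z" "fwd x y \<in> I"
    using point_obj_mono[OF act_in[OF c \<beta>], of 1 2] point_obj_in[OF act_in[OF c \<beta>], of 1]
    by simp_all
qed

text \<open>In \<open>b, y, z, x, t\<close> a turn has length 4, so 5 and 6 are the next copies of
  \<open>y\<close> and \<open>z\<close>, and both arcs are entries of the chain with origin
  \<open>x\<close>.\<close>

lemma bwd_mono:
  assumes "x \<in> I" "y \<in> I" "z \<in> I" "y \<le> z" "z \<le> x"
  shows "bwd x y \<le> bwd x z"
proof -
  let ?c = "jumps 3 [3, 5, 6]"
  have c: "?c \<in> Lambda_lift 2 3" by (intro jumps_Lambda_lift) auto
  have \<beta>: "chain [y, z, x] \<in> Pt 3" using assms by (intro chain_in) auto
  have "?c 0 = 3" "?c 1 = 5" "?c 2 = 6"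
    using jumps_of_nat[of 0 "[3, 5, 6]" 3] jumps_of_nat[of 1 "[3, 5, 6]" 3]
      jumps_of_nat[of 2 "[3, 5, 6]" 3] by simp_all
  then have "act 3 2 ?c (chain [y, z, x]) 1 = bwd x y" "act 3 2 ?c (chain [y, z, x]) 2 = bwd x z"
    using act_eq[OF \<beta> c, of 1] act_eq[OF \<beta> c, of 2] by (simp_all add: chain_nth)
  then show ?thesis
    using point_obj_mono[OF act_in[OF c \<beta>], of 1 2] by simp
qed

text \<open>The arc left over after \<open>x\<close>, in the role of a complement
  \<open>t - x\<close>.\<close>

definition turn :: "'a \<Rightarrow> 'a" where
  "turn x = fwd x t"

lemma turn_in: "x \<in> I \<Longrightarrow> turn x \<in> I"
  unfolding turn_def by (rule fwd_mono(2)[of x t t]) (use in_interval in auto)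

lemma fwd_le_turn: "\<lbrakk>x \<in> I; y \<in> I; x \<le> y\<rbrakk> \<Longrightarrow> fwd x y \<le> turn x"
  unfolding turn_def by (rule fwd_mono) (use in_interval in auto)

lemma fwd_in: "\<lbrakk>x \<in> I; y \<in> I; x \<le> y\<rbrakk> \<Longrightarrow> fwd x y \<in> I"
  by (rule fwd_mono(2)[of x y y]) auto

text \<open>On \<open>[1]\<close> the rotation by 1 acts on the single interior point as
  \<open>turn\<close>, and its square is a full turn.\<close>

lemma turn_turn:
  assumes x: "x \<in> I" shows "turn (turn x) = x"
proof -
  let ?r = "act 1 1 (\<lambda>x. x + 1)"
  have r: "?r (chain [y]) 1 = turn y" if "y \<in> I" for y
    using act_eq[OF chain_in[of "[y]" 1] shift_Lambda_lift[of 1], of 1] that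
    by (simp add: chain_nth turn_def)
  have in1: "chain [y] \<in> Pt 1" if "y \<in> I" for y using that by (intro chain_in) auto
  have "?r (chain [x]) = chain [turn x]"
  proof (rule point_obj_eqI[OF act_in[OF shift_Lambda_lift in1[OF x]] in1[OF turn_in[OF x]]])
    fix j :: nat assume "j \<le> 1 + 1"
    then consider "j = 0" | "j = 1" | "j = 1 + 1" by linarith
    then show "?r (chain [x]) j = chain [turn x] j"
    proof cases
      case 2
      then show ?thesis using r[OF x] by (simp add: chain_nth)
    qed (use point_obj_ends[OF act_in[OF shift_Lambda_lift in1[OF x]]]
        point_obj_ends[OF in1[OF turn_in[OF x]]] in auto)
  qed
  then show ?thesis
    using act_shift_inverse[OF in1[OF x], of 1 1] r[OF x] r[OF turn_in[OF x]]
    by (simp add: chain_nth)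
qed

lemma chain2_in: "\<lbrakk>x \<in> I; y \<in> I; x \<le> y\<rbrakk> \<Longrightarrow> chain [x, y] \<in> Pt 2"
  by (intro chain_in) auto

lemma point_obj_2_eq_chain:
  assumes "\<beta> \<in> Pt 2" shows "\<beta> = chain [\<beta> 1, \<beta> 2]"
proof (rule point_obj_eqI[OF assms])
  show "chain [\<beta> 1, \<beta> 2] \<in> Pt 2"
    using assms by (intro chain2_in) (auto intro: point_obj_in point_obj_mono)
  fix j :: nat assume "j \<le> 2 + 1"
  then have "j = 0 \<or> j = 1 \<or> j = 2 \<or> j = 3" by auto
  then show "\<beta> j = chain [\<beta> 1, \<beta> 2] j"
    using point_obj_ends[OF assms] by - (elim disjE, simp_all add: chain_nth)
qed

text \<open>Rotating \<open>b, x, y, t\<close> moves the origin to \<open>x\<close> or to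
  \<open>y\<close>; the new entries are arcs from there, and \<open>turn\<close> is the arc ending
  at \<open>t\<close>.\<close>

lemma rotate_chain2:
  assumes "x \<in> I" "y \<in> I" "x \<le> y"
  shows rotate_chain2_1: "act 2 2 (\<lambda>x. x + 1) (chain [x, y]) = chain [fwd x y, turn x]"
    and rotate_chain2_2: "act 2 2 (\<lambda>x. x + 2) (chain [x, y]) = chain [turn y, bwd y x]"
proof -
  note \<beta> = chain2_in[OF assms]
  have *: "act 2 2 (\<lambda>x. x + 1) (chain [x, y]) 1 = fwd x y"
    "act 2 2 (\<lambda>x. x + 1) (chain [x, y]) 2 = turn x"
    "act 2 2 (\<lambda>x. x + 2) (chain [x, y]) 1 = turn y"
    "act 2 2 (\<lambda>x. x + 2) (chain [x, y]) 2 = bwd y x"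
    using act_eq[OF \<beta> shift_Lambda_lift[of 1], of 1] act_eq[OF \<beta> shift_Lambda_lift[of 1], of 2]
      act_eq[OF \<beta> shift_Lambda_lift[of 2], of 1] act_eq[OF \<beta> shift_Lambda_lift[of 2], of 2]
    by (simp_all add: chain_nth turn_def)
  show "act 2 2 (\<lambda>x. x + 1) (chain [x, y]) = chain [fwd x y, turn x]"
    "act 2 2 (\<lambda>x. x + 2) (chain [x, y]) = chain [turn y, bwd y x]"
    by (rule point_obj_2_eq_chain[OF act_in[OF shift_Lambda_lift[of 1] \<beta>], unfolded *]
        point_obj_2_eq_chain[OF act_in[OF shift_Lambda_lift[of 2] \<beta>], unfolded *])+
qed

lemma chain2_inject: "chain [x, y] = chain [x', y'] \<Longrightarrow> x = x' \<and> y = y'"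
proof -
  assume eq: "chain [x, y] = chain [x', y']"
  show ?thesis using fun_cong[OF eq, of 1] fun_cong[OF eq, of 2] by (simp add: chain_nth)
qed

text \<open>Rotating \<open>[2]\<close> by 1 and then by 2 is a full turn, so the second interior
  point must come back as \<open>y\<close>.\<close>

lemma bwd_fwd:
  assumes "x \<in> I" "y \<in> I" "x \<le> y" shows "bwd (turn x) (fwd x y) = y"
proof -
  have "act 2 2 (\<lambda>x. x + 2) (chain [fwd x y, turn x]) = chain [x, y]"
    using act_shift_inverse[OF chain2_in[OF assms], of 2 1] rotate_chain2_1[OF assms] by simp
  then show ?thesis
    using rotate_chain2_2[OF fwd_in[OF assms] turn_in fwd_le_turn[OF assms]] assms
    by (auto dest: chain2_inject)
qed

lemma bwd_bounds:
  assumes "x \<in> I" "y \<in> I" "y \<le> x" shows "bwd x y \<in> I" "turn x \<le> bwd x y"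
proof -
  have *: "act 2 2 (\<lambda>x. x + 2) (chain [y, x]) \<in> Pt 2"
    by (rule act_in[OF shift_Lambda_lift chain2_in]) (use assms in auto)
  show "bwd x y \<in> I" "turn x \<le> bwd x y"
    using point_obj_in[OF *, of 2] point_obj_mono[OF *, of 1 2]
      rotate_chain2_2[OF assms(2,1,3)] by (simp_all add: chain_nth)
qed

lemma fwd_bwd:
  assumes "x \<in> I" "y \<in> I" "y \<le> x" shows "fwd (turn x) (bwd x y) = y"
proof -
  have "act 2 2 (\<lambda>x. x + 1) (chain [turn x, bwd x y]) = chain [y, x]"
    using act_shift_inverse[OF chain2_in[OF assms(2,1,3)], of 1 2] rotate_chain2_2[OF assms(2,1,3)] by simp
  then show ?thesis
    using rotate_chain2_1[OF turn_in[OF assms(1)] bwd_bounds[OF assms]]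
    by (auto dest: chain2_inject)
qed

lemma fwd_less:
  assumes "x \<in> I" "y \<in> I" "z \<in> I" "x \<le> y" "y < z" shows "fwd x y < fwd x z"
proof -
  have "bwd (turn x) (fwd x y) = y" "bwd (turn x) (fwd x z) = z"
    using assms by (auto intro: bwd_fwd)
  then show ?thesis using fwd_mono(1)[of x y z] assms by (auto simp: order_less_le)
qed

lemma bwd_less:
  assumes "x \<in> I" "y \<in> I" "z \<in> I" "y < z" "z \<le> x" shows "bwd x y < bwd x z"
proof -
  have "fwd (turn x) (bwd x y) = y" "fwd (turn x) (bwd x z) = z"
    using assms by (auto intro: fwd_bwd)
  then show ?thesis using bwd_mono[of x y z] assms by (auto simp: order_less_le)
qed

text \<open>This is \<open>bwd_fwd\<close> at \<open>turn x\<close> and \<open>t\<close>, because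
  \<open>fwd (turn x) t = turn (turn x) = x\<close>.\<close>

lemma bwd_self: "x \<in> I \<Longrightarrow> bwd x x = t"
  using bwd_fwd[of "turn x" t] turn_turn[of x] turn_in[of x] in_interval
  by (simp flip: turn_def)

text \<open>By \<open>fwd_bwd\<close> the value \<open>b\<close> is attained at some point above
  \<open>x\<close>, hence by monotonicity already at \<open>x\<close>.\<close>

lemma fwd_self: "x \<in> I \<Longrightarrow> fwd x x = b"
proof -
  assume x: "x \<in> I"
  have "fwd x (bwd (turn x) b) = b" "x \<le> bwd (turn x) b" "bwd (turn x) b \<in> I"
    using fwd_bwd[of "turn x" b] bwd_bounds[of "turn x" b] turn_turn[OF x] turn_in[OF x] in_interval
    by auto
  then show ?thesis
    using fwd_mono(1)[OF x x, of "bwd (turn x) b"] fwd_in[OF x x] in_interval(4) x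
    by (intro antisym) auto
qed

end

subsection \<open>Homogeneity of the glued line\<close>

lemma order_automorphism_comp:
  "\<lbrakk>order_automorphism X le \<phi>; order_automorphism X le \<psi>\<rbrakk> \<Longrightarrow> order_automorphism X le (\<psi> \<circ> \<phi>)"
  unfolding order_automorphism_def by (auto intro: bij_betw_trans dest: bij_betwE)

lemma order_automorphism_inv_into:
  assumes "order_automorphism X le \<phi>" shows "order_automorphism X le (inv_into X \<phi>)"
proof -
  have bij: "bij_betw \<phi> X X" and le: "\<And>x y. x \<in> X \<Longrightarrow> y \<in> X \<Longrightarrow> le (\<phi> x) (\<phi> y) \<longleftrightarrow> le x y"
    using assms by (auto simp: order_automorphism_def)
  have "inv_into X \<phi> x \<in> X" "\<phi> (inv_into X \<phi> x) = x" if "x \<in> X" for x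
    using bij that bij_betw_inv_into_right bij_betwE bij_betw_inv_into by metis+
  then show ?thesis
    using le bij_betw_inv_into[OF bij] unfolding order_automorphism_def by metis
qed

text \<open>The map for \<open>p\<close> followed by the inverse of the map for \<open>q\<close>
  carries \<open>p\<close> to \<open>q\<close> through the base point.\<close>

lemma homogeneous_orderI:
  assumes p0: "p\<^sub>0 \<in> X" and ex: "\<And>p. p \<in> X \<Longrightarrow> \<exists>\<phi>. order_automorphism X le \<phi> \<and> \<phi> p = p\<^sub>0"
  shows "homogeneous_order X le"
  unfolding homogeneous_order_def
proof (intro ballI)
  fix p q assume "p \<in> X" "q \<in> X"
  then obtain \<phi> \<psi> where \<phi>: "order_automorphism X le \<phi>" "\<phi> p = p\<^sub>0"
    and \<psi>: "order_automorphism X le \<psi>" "\<psi> q = p\<^sub>0"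
    using ex by metis
  then have "inv_into X \<psi> p\<^sub>0 = q"
    using inv_into_f_f[of \<psi> X q] \<open>q \<in> X\<close> by (simp add: order_automorphism_def bij_betw_def)
  then show "\<exists>\<phi>. order_automorphism X le \<phi> \<and> \<phi> p = q"
    using order_automorphism_comp[OF \<phi>(1) order_automorphism_inv_into[OF \<psi>(1)]] \<phi>(2)
    by (intro exI[of _ "inv_into X \<psi> \<circ> \<phi>"]) simp
qed

lemma homogeneous_order_transfer:
  assumes hom: "homogeneous_order X le" and bij: "bij_betw h X Y"
    and le: "\<And>p q. \<lbrakk>p \<in> X; q \<in> X\<rbrakk> \<Longrightarrow> le' (h p) (h q) \<longleftrightarrow> le p q"
  shows "homogeneous_order Y le'"
  unfolding homogeneous_order_def
proof (intro ballI)
  fix x y assume xy: "x \<in> Y" "y \<in> Y"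
  let ?g = "inv_into X h"
  have g: "?g z \<in> X" "h (?g z) = z" if "z \<in> Y" for z
    using bij that bij_betw_inv_into_right bij_betwE bij_betw_inv_into by metis+
  obtain \<phi> where \<phi>: "order_automorphism X le \<phi>" "\<phi> (?g x) = ?g y"
    using hom g xy unfolding homogeneous_order_def by blast
  then have bij\<phi>: "bij_betw \<phi> X X"
    and le\<phi>: "\<And>p q. p \<in> X \<Longrightarrow> q \<in> X \<Longrightarrow> le (\<phi> p) (\<phi> q) \<longleftrightarrow> le p q"
    by (auto simp: order_automorphism_def)
  have "order_automorphism Y le' (h \<circ> (\<phi> \<circ> ?g))"
    unfolding order_automorphism_def
  proof (intro conjI ballI)
    show "bij_betw (h \<circ> (\<phi> \<circ> ?g)) Y Y"
      using bij bij\<phi> bij_betw_inv_into by (blast intro: bij_betw_trans)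
    fix u v assume uv: "u \<in> Y" "v \<in> Y"
    then have "le' (h (\<phi> (?g u))) (h (\<phi> (?g v))) \<longleftrightarrow> le (?g u) (?g v)"
      using g le le\<phi> bij_betwE[OF bij\<phi>] by simp
    also have "\<dots> \<longleftrightarrow> le' (h (?g u)) (h (?g v))" using g le uv by blast
    also have "\<dots> \<longleftrightarrow> le' u v" using g uv by simp
    finally show "le' ((h \<circ> (\<phi> \<circ> ?g)) u) ((h \<circ> (\<phi> \<circ> ?g)) v) \<longleftrightarrow> le' u v"
      by simp
  qed
  then show "\<exists>\<phi>. order_automorphism Y le' \<phi> \<and> \<phi> x = y"
    using \<phi>(2) g xy by (intro exI[of _ "h \<circ> (\<phi> \<circ> ?g)"]) simp
qed

section \<open>The glued line as \<open>UNIV \<times> (I - {t})\<close> with the lexicographic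
  order\<close>

lemma lex_le_antisym: "\<lbrakk>lex_le p q; lex_le q p\<rbrakk> \<Longrightarrow> p = q"
  by (auto simp: lex_le_def prod_eq_iff)

lemma lex_le_linear: "lex_le p q \<or> lex_le q p"
  by (auto simp: lex_le_def)

lemma glue_class_eq:
  assumes "order_interval I b t" "x \<in> I"
  shows "glue_rel I b t `` {(n, x)} =
    (if x = b then {(n, b), (n - 1, t)} else if x = t then {(n, t), (n + 1, b)} else {(n, x)})"
  using assms by (auto simp: glue_rel_def order_interval_def)

lemma glue_class_le_iff:
  assumes I: "order_interval I b t" and p: "p \<in> UNIV \<times> (I - {t})" and q: "q \<in> UNIV \<times> (I - {t})"
  shows "glued_le (glue_rel I b t `` {p}) (glue_rel I b t `` {q}) \<longleftrightarrow> lex_le p q"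
proof -
  obtain n x m y where pq: "p = (n, x)" "q = (m, y)" by (metis surj_pair)
  have "b < t" "b \<le> x" "b \<le> y" "x < t" "y < t"
    using I p q by (auto simp: pq order_interval_def order_less_le)
  then show ?thesis
    using p q by (auto simp: pq glue_class_eq[OF I] glued_le_def lex_le_def)
qed

text \<open>As \<open>(n, t)\<close> is glued to \<open>(n + 1, b)\<close>, each class has one
  representative avoiding \<open>t\<close>; injectivity is read off from the order
  comparison.\<close>

lemma bij_betw_glue_class:
  assumes I: "order_interval I b t"
  shows "bij_betw (\<lambda>p. glue_rel I b t `` {p}) (UNIV \<times> (I - {t})) (glued_line I b t)"
  unfolding bij_betw_def
proof
  show "inj_on (\<lambda>p. glue_rel I b t `` {p}) (UNIV \<times> (I - {t}))"
  proof (rule inj_onI)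
    fix p q assume pq: "p \<in> UNIV \<times> (I - {t})" "q \<in> UNIV \<times> (I - {t})"
      and eq: "glue_rel I b t `` {p} = glue_rel I b t `` {q}"
    have "lex_le p p" by (simp add: lex_le_def)
    then have "lex_le p q" "lex_le q p"
      using glue_class_le_iff[OF I] pq eq by metis+
    then show "p = q" by (rule lex_le_antisym)
  qed
  have "glue_rel I b t `` {(n, x)} \<in> (\<lambda>p. glue_rel I b t `` {p}) ` (UNIV \<times> (I - {t}))" if "x \<in> I" for n x
  proof (cases "x = t")
    case True
    then have "glue_rel I b t `` {(n, x)} = glue_rel I b t `` {(n + 1, b)}"
      using I glue_class_eq[OF I] by (auto simp: order_interval_def)
    moreover have "b \<in> I - {t}" using I by (auto simp: order_interval_def)
    ultimately show ?thesis by blast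
  qed (use that in blast)
  then show "(\<lambda>p. glue_rel I b t `` {p}) ` (UNIV \<times> (I - {t})) = glued_line I b t"
    unfolding glued_line_def quotient_def by auto
qed

section \<open>Translations of the glued line\<close>

context cyclic_point
begin

text \<open>Positions are measured anew from \<open>x\<close>: a point below \<open>x\<close>
  belongs to the turn that began at \<open>x\<close> one level lower, hence
  \<open>fst p - 1\<close>.\<close>

definition translate :: "'a \<Rightarrow> int \<times> 'a \<Rightarrow> int \<times> 'a" where
  "translate x p = (if x \<le> snd p then (fst p, fwd x (snd p)) else (fst p - 1, bwd x (snd p)))"

lemma translate_in:
  assumes "x \<in> I" "p \<in> UNIV \<times> (I - {t})" shows "translate x p \<in> UNIV \<times> (I - {t})"
proof -
  obtain n y where p: "p = (n, y)" by (metis surj_pair)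
  have y: "y \<in> I" "y < t" using assms(2) in_interval(5) by (auto simp: p order_less_le)
  show ?thesis
  proof (cases "x \<le> y")
    case True
    then have "fwd x y < fwd x t" using fwd_less[of x y t] assms y in_interval by auto
    moreover have "fwd x t \<le> t" using turn_in[OF assms(1)] in_interval(5) by (simp add: turn_def)
    ultimately show ?thesis using True fwd_in[OF assms(1) y(1)] by (auto simp: p translate_def)
  next
    case False
    then have "bwd x y < bwd x x" using bwd_less[of x y x] assms y by auto
    then show ?thesis using False bwd_bounds[OF assms(1) y(1)] bwd_self[OF assms(1)]
      by (auto simp: p translate_def)
  qed
qed

text \<open>Moving the origin by \<open>x\<close> and then by the remaining arc
  \<open>turn x\<close> makes a full turn. Since \<open>turn x\<close> separates forward from
  backward arcs, the second map always takes the opposite branch.\<close>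

lemma translate_translate:
  assumes "x \<in> I" "p \<in> UNIV \<times> (I - {t})"
  shows "translate (turn x) (translate x p) = (fst p - 1, snd p)"
proof -
  obtain n y where p: "p = (n, y)" by (metis surj_pair)
  have y: "y \<in> I" "y < t" using assms(2) in_interval(5) by (auto simp: p order_less_le)
  show ?thesis
  proof (cases "x \<le> y")
    case True
    then have "fwd x y < turn x" using fwd_less[of x y t] assms y in_interval by (auto simp: turn_def)
    then show ?thesis using True bwd_fwd[OF assms(1) y(1)] by (simp add: p translate_def)
  next
    case False
    then show ?thesis using bwd_bounds[OF assms(1) y(1)] fwd_bwd[OF assms(1) y(1)]
      by (simp add: p translate_def)
  qed
qed

lemma translate_shift: "translate x (n + k, y) = (fst (translate x (n, y)) + k, snd (translate x (n, y)))"
  by (simp add: translate_def)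

lemma translate_lex_le:
  assumes x: "x \<in> I" and p: "p \<in> UNIV \<times> (I - {t})" and q: "q \<in> UNIV \<times> (I - {t})" and le: "lex_le p q"
  shows "lex_le (translate x p) (translate x q)"
proof -
  obtain n y m z where pq: "p = (n, y)" "q = (m, z)" by (metis surj_pair)
  have yz: "y \<in> I" "z \<in> I" using p q by (auto simp: pq)
  \<comment> \<open>The mixed case: \<open>(n, y)\<close> with \<open>x \<le> y\<close> and
    \<open>(n + 1, z)\<close> with \<open>z < x\<close> land on the same level.\<close>
  have "fwd x y \<le> bwd x z" if "x \<le> y" "z \<le> x"
    using fwd_le_turn[OF x yz(1) that(1)] bwd_bounds(2)[OF x yz(2) that(2)] by simp
  then show ?thesis
    using le fwd_mono(1)[OF x yz] bwd_mono[OF x yz] by (auto simp: pq lex_le_def translate_def)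
qed

lemma order_automorphism_translate:
  assumes x: "x \<in> I" shows "order_automorphism (UNIV \<times> (I - {t})) lex_le (translate x)"
proof -
  let ?X = "UNIV \<times> (I - {t})"
  \<comment> \<open>The inverse: by \<open>translate_translate\<close> the two translations together
    lose one turn, which the shift \<open>fst p + 1\<close> restores.\<close>
  let ?g = "\<lambda>p. translate (turn x) (fst p + 1, snd p)"
  have left: "?g (translate x p) = p" if "p \<in> ?X" for p
    using translate_translate[OF x that]
      translate_shift[of "turn x" "fst (translate x p)" 1 "snd (translate x p)"] by simp
  have right: "translate x (?g p) = p" if "p \<in> ?X" for p
    using translate_translate[of "turn x" "(fst p + 1, snd p)"] turn_turn[OF x] turn_in[OF x] that
    by (cases p) simp
  have bij: "bij_betw (translate x) ?X ?X"
  proof (rule bij_betw_byWitness[where f' = ?g])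
    show "?g ` ?X \<subseteq> ?X"
    proof
      fix p assume "p \<in> ?g ` ?X"
      then obtain q where "q \<in> ?X" "p = ?g q" by blast
      moreover have "(fst q + 1, snd q) \<in> ?X" using \<open>q \<in> ?X\<close> by auto
      ultimately show "p \<in> ?X" using translate_in[OF turn_in[OF x]] by metis
    qed
    show "translate x ` ?X \<subseteq> ?X" using translate_in[OF x] by blast
  qed (use left right in blast)+
  have "lex_le p q" if "p \<in> ?X" "q \<in> ?X" "lex_le (translate x p) (translate x q)" for p q
  proof (rule ccontr)
    assume "\<not> lex_le p q"
    then have "lex_le q p" using lex_le_linear by blast
    then have "translate x p = translate x q"
      using that translate_lex_le[OF x] lex_le_antisym by blast
    then have "p = q" using bij that by (auto simp: bij_betw_def inj_on_def)
    then show False using \<open>\<not> lex_le p q\<close> lex_le_linear by blast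
  qed
  then show ?thesis
    using bij translate_lex_le[OF x] unfolding order_automorphism_def by blast
qed

lemma homogeneous_glued_line: "homogeneous_order (glued_line I b t) glued_le"
proof (rule homogeneous_order_transfer[where h = "\<lambda>p. glue_rel I b t `` {p}",
      OF _ bij_betw_glue_class[OF interval]])
  let ?X = "UNIV \<times> (I - {t}) :: (int \<times> 'a) set"
  show "homogeneous_order ?X lex_le"
  proof (rule homogeneous_orderI[of "(0, b)"])
    show "(0, b) \<in> ?X" using in_interval by auto
    fix p :: "int \<times> 'a" assume p: "p \<in> ?X"
    \<comment> \<open>Translation by \<open>snd p\<close> carries \<open>p\<close> to
      \<open>(fst p, b)\<close>; this shift brings it to level 0.\<close>
    let ?s = "\<lambda>q :: int \<times> 'a. (fst q - fst p, snd q)"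
    have "order_automorphism ?X lex_le ?s"
      unfolding order_automorphism_def
      by (auto simp: lex_le_def intro!: bij_betw_byWitness[where f' = "\<lambda>q. (fst q + fst p, snd q)"])
    moreover have snd: "snd p \<in> I" using p by auto
    ultimately have "order_automorphism ?X lex_le (?s \<circ> translate (snd p))"
      by (intro order_automorphism_comp order_automorphism_translate)
    moreover have "(?s \<circ> translate (snd p)) p = (0, b)"
      using fwd_self[OF snd] by (simp add: translate_def)
    ultimately show "\<exists>\<phi>. order_automorphism ?X lex_le \<phi> \<and> \<phi> p = (0, b)" by blast
  qed
qed (rule glue_class_le_iff[OF interval])

end

section \<open>An interval without cyclic structure\<close>

lemma no_cyclic_structure_with_gap:
  "\<not> cyclic_structure (insert 0 {1..2} :: real set) 0 2 F"
proof
  let ?I = "insert 0 {1..2} :: real set"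
  assume "cyclic_structure ?I 0 2 F"
  then interpret cyclic_point ?I 0 2 F
    by unfold_locales (auto simp: order_interval_def)
  have turn: "turn 1 \<in> ?I" by (rule turn_in) simp
  have "turn 1 \<noteq> 0" using fwd_less[of 1 1 2] fwd_self[of 1] by (simp add: turn_def)
  \<comment> \<open>Hence 1, the successor of 0 in this interval, lies in the range of
    \<open>fwd 1\<close>; its preimage is \<open>p\<close>.\<close>
  then have "1 \<le> turn 1" using turn by auto
  define p where "p = bwd (turn 1) 1"
  have p: "p \<in> ?I" "1 \<le> p" "fwd 1 p = 1"
    using bwd_bounds[OF turn _ \<open>1 \<le> turn 1\<close>] fwd_bwd[OF turn _ \<open>1 \<le> turn 1\<close>] turn_turn[of 1]
    by (simp_all add: p_def)
  then have "p \<noteq> 1" using fwd_self[of 1] by auto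
  \<comment> \<open>The arc from 1 to this midpoint would lie strictly between 0 and 1, where the
    interval has no element.\<close>
  define q where "q = (1 + p) / 2"
  have q: "q \<in> ?I" "1 < q" "q < p" using p \<open>p \<noteq> 1\<close> by (auto simp: q_def)
  have "fwd 1 1 < fwd 1 q" "fwd 1 q < fwd 1 p"
    using fwd_less[of 1 1 q] fwd_less[of 1 q p] q p by auto
  moreover have "fwd 1 q \<in> ?I" by (rule fwd_in) (use q in auto)
  ultimately show False using fwd_self[of 1] p(3) by auto
qed

subsection \<open>Finite intervals\<close>

definition rank :: "'a::linorder set \<Rightarrow> 'a \<Rightarrow> nat" where
  "rank I x = card {y \<in> I. y < x}"

lemma rank_less: "\<lbrakk>finite I; x \<in> I; x < y\<rbrakk> \<Longrightarrow> rank I x < rank I y"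
  unfolding rank_def by (intro psubset_card_mono) auto

lemma rank_le: "\<lbrakk>finite I; x \<le> y\<rbrakk> \<Longrightarrow> rank I x \<le> rank I y"
  unfolding rank_def by (intro card_mono) auto

lemma rank_inject: "\<lbrakk>finite I; x \<in> I; y \<in> I\<rbrakk> \<Longrightarrow> rank I x = rank I y \<longleftrightarrow> x = y"
  by (metis less_irrefl linorder_less_linear rank_less)

lemma bij_betw_rank:
  assumes fin: "finite I" shows "bij_betw (rank I) I {..<card I}"
proof -
  have inj: "inj_on (rank I) I" using rank_inject[OF fin] by (auto intro: inj_onI)
  have "rank I ` I \<subseteq> {..<card I}"
    using fin by (auto simp: rank_def intro!: psubset_card_mono)
  moreover have "card (rank I ` I) = card {..<card I}" using inj by (simp add: card_image)
  ultimately have "rank I ` I = {..<card I}" by (intro card_subset_eq) auto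
  then show ?thesis using inj by (simp add: bij_betw_def)
qed

text \<open>\<open>fwd x\<close> maps the elements from \<open>x\<close> up to \<open>y\<close>
  bijectively onto those below \<open>fwd x y\<close>; surjectivity comes from its inverse
  \<open>bwd (turn x)\<close>. The count on the right does not mention \<open>F\<close>.\<close>

lemma (in cyclic_point) rank_fwd:
  assumes "x \<in> I" "y \<in> I" "x \<le> y"
  shows "rank I (fwd x y) = card {z \<in> I. x \<le> z \<and> z < y}"
proof -
  have "{u \<in> I. u < fwd x y} = fwd x ` {z \<in> I. x \<le> z \<and> z < y}"
  proof (intro equalityI subsetI)
    fix u assume "u \<in> {u \<in> I. u < fwd x y}"
    then have u: "u \<in> I" "u < fwd x y" by auto
    then have le: "u \<le> turn x" using fwd_le_turn[OF assms] by simp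
    let ?z = "bwd (turn x) u"
    have z: "fwd x ?z = u" "?z \<in> I" "x \<le> ?z"
      using fwd_bwd[OF turn_in u(1) le] bwd_bounds[OF turn_in u(1) le] turn_turn assms(1) by auto
    moreover have "?z < y"
    proof (rule ccontr)
      assume "\<not> ?z < y"
      then have "y \<le> ?z" by simp
      then show False using fwd_mono(1)[of x y ?z] assms z u(2) by auto
    qed
    ultimately show "u \<in> fwd x ` {z \<in> I. x \<le> z \<and> z < y}" by force
  qed (use assms in \<open>auto intro: fwd_in fwd_less\<close>)
  moreover have "inj_on (fwd x) {z \<in> I. x \<le> z \<and> z < y}"
    using bwd_fwd[OF assms(1)] by (intro inj_on_inverseI[where g = "bwd (turn x)"]) auto
  ultimately show ?thesis by (simp add: rank_def card_image)
qed

text \<open>Ranks fix \<open>fwd\<close>, hence \<open>turn\<close> and the inverse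
  \<open>bwd\<close>; by \<open>act_eq\<close> these determine the action of every arrow.\<close>

lemma cyclic_structure_unique:
  fixes I :: "'a::linorder set"
  assumes I: "order_interval I b t" and fin: "finite I"
    and F: "cyclic_structure I b t F" and G: "cyclic_structure I b t G"
  shows "F = G"
proof -
  interpret F: cyclic_point I b t F by unfold_locales (fact I F)+
  interpret G: cyclic_point I b t G by unfold_locales (fact I G)+
  have fwd: "F.fwd x y = G.fwd x y" if "x \<in> I" "y \<in> I" "x \<le> y" for x y
    using F.rank_fwd[OF that] G.rank_fwd[OF that] rank_inject[OF fin F.fwd_in[OF that] G.fwd_in[OF that]]
    by simp
  have turn: "F.turn x = G.turn x" if "x \<in> I" for x
    unfolding F.turn_def G.turn_def using that F.in_interval by (intro fwd) auto
  have bwd: "F.bwd x y = G.bwd x y" if "x \<in> I" "y \<in> I" "y \<le> x" for x y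
  proof -
    have "G.fwd (G.turn x) (F.bwd x y) = y"
      using F.fwd_bwd[OF that] fwd[OF F.turn_in F.bwd_bounds[OF that]] turn that by simp
    moreover have "G.bwd (G.turn (G.turn x)) (G.fwd (G.turn x) (F.bwd x y)) = F.bwd x y"
      using F.bwd_bounds[OF that] turn that G.turn_in by (intro G.bwd_fwd) auto
    ultimately show ?thesis using G.turn_turn that by simp
  qed
  have "Fmap F n m \<phi> \<beta> = Fmap G n m \<phi> \<beta>"
    if \<phi>: "\<phi> \<in> Lambda_hom n m" and \<beta>: "\<beta> \<in> F.Pt n" for n m \<phi> \<beta>
  proof -
    obtain f where f: "f \<in> Lambda_lift n m" "\<phi> = Lambda_class n m f"
      using \<phi> by (rule Lambda_hom_cases)
    define c\<^sub>1 where "c\<^sub>1 = lower_adj f"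
    \<comment> \<open>Full turns are removed so that \<open>c 0\<close> becomes a residue in
      \<open>{0..n}\<close>, as \<open>act_eq\<close> requires.\<close>
    define c where "c = (\<lambda>x. c\<^sub>1 x + (- (c\<^sub>1 0 div (int n + 1))) * (int n + 1))"
    have c\<^sub>1: "c\<^sub>1 \<in> Lambda_lift m n" using lower_adj[OF f(1)] by (simp add: c\<^sub>1_def)
    then have c: "c \<in> Lambda_lift m n" unfolding c_def by (rule Lambda_lift_add)
    have "c 0 = c\<^sub>1 0 mod (int n + 1)"
      unfolding c_def by (simp only: minus_mult_left[symmetric] minus_div_mult_eq_mod[symmetric])
    then have c0: "0 \<le> c 0" "c 0 \<le> int n" using pos_mod_bound[of "int n + 1" "c\<^sub>1 0"] by auto
    have eq: "Fmap F n m \<phi> = F.act n m c" "Fmap G n m \<phi> = G.act n m c"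
      unfolding c_def F.act_shift[OF c\<^sub>1] G.act_shift[OF c\<^sub>1]
      by (simp_all add: F.act_def G.act_def c\<^sub>1_def upper_adj_lower_adj[OF f(1)] f(2))
    show ?thesis
      unfolding eq
    proof (rule point_obj_eqI[OF F.act_in[OF c \<beta>] G.act_in[OF c \<beta>]])
      fix j assume j: "j \<le> m + 1"
      have cj: "c 0 \<le> c (int j)" "c (int j) \<le> c 0 + int n + 1"
        using Lambda_lift_mono[OF c, of 0 "int j"] Lambda_lift_mono[OF c, of "int j" "int m + 1"]
          Lambda_lift_shift[OF c, of 0] j by auto
      have \<beta>I: "\<beta> (nat k) \<in> I" if "k \<le> int n + 1" for k
        using that by (intro point_obj_in[OF \<beta>]) simp
      have \<beta>mono: "\<beta> (nat k) \<le> \<beta> (nat l)" if "k \<le> l" "l \<le> int n + 1" for k l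
        using that by (intro point_obj_mono[OF \<beta>]) auto
      show "F.act n m c \<beta> j = G.act n m c \<beta> j"
        using F.act_eq[OF \<beta> c c0(1) _ j] G.act_eq[OF \<beta> c c0(1) _ j] c0(2) cj
        by (auto intro!: fwd bwd \<beta>I \<beta>mono)
    qed
  qed
  note eq = this
  \<comment> \<open>Off the hom-sets and point sets every cyclic structure is
    \<open>undefined\<close>, so agreement on them gives equality.\<close>
  have ext: "Fmap H n m \<in> Lambda_hom n m \<rightarrow>\<^sub>E (F.Pt n \<rightarrow>\<^sub>E F.Pt m)" if "cyclic_structure I b t H" for H n m
  proof -
    interpret H: cyclic_point I b t H by unfold_locales (fact I that)+
    show ?thesis using that H.Fobj_eq by (simp add: cyclic_structure_def Lambda_functor_def)
  qed
  have "Fmap F n m = Fmap G n m" for n m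
  proof (rule PiE_ext[OF ext[OF F] ext[OF G]])
    fix \<phi> assume \<phi>: "\<phi> \<in> Lambda_hom n m"
    show "Fmap F n m \<phi> = Fmap G n m \<phi>"
      by (rule PiE_ext[OF PiE_mem[OF ext[OF F] \<phi>] PiE_mem[OF ext[OF G] \<phi>]]) (rule eq[OF \<phi>])
  qed
  then have "Fmap F = Fmap G" by (simp add: fun_eq_iff)
  then show ?thesis using F.Fobj_eq G.Fobj_eq by simp
qed

lemma upper_star_le: "upper_star n f j \<le> n + 1"
proof (cases "\<exists>i\<in>{0..n}. j \<le> f i")
  case True
  then have "Min {i \<in> {0..n}. j \<le> f i} \<in> {i \<in> {0..n}. j \<le> f i}" by (intro Min_in) auto
  then show ?thesis using True by (simp add: upper_star_def)
qed (simp add: upper_star_def)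

section \<open>Existence for finite intervals: chains of integers\<close>

locale finite_interval =
  fixes I :: "'a::linorder set" and b t
  assumes interval: "order_interval I b t" and fin: "finite I"
begin

definition top_rank :: nat where "top_rank = card I - 1"

lemma in_interval: "b \<in> I" "t \<in> I" "b < t" "x \<in> I \<Longrightarrow> b \<le> x" "x \<in> I \<Longrightarrow> x \<le> t"
  using interval by (auto simp: order_interval_def)

lemma rank_b: "rank I b = 0"
  using in_interval(4) by (auto simp: rank_def fin leD)

lemma rank_t: "rank I t = top_rank"
proof -
  have "{y \<in> I. y < t} = I - {t}" using in_interval(5) by (auto simp: order_less_le)
  then show ?thesis using in_interval(2) fin by (simp add: rank_def top_rank_def)
qed

definition unrank :: "int \<Rightarrow> 'a" where
  "unrank i = inv_into I (rank I) (nat i)"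

lemma unrank_rank: "x \<in> I \<Longrightarrow> unrank (int (rank I x)) = x"
  using bij_betw_rank[OF fin] by (simp add: unrank_def bij_betw_def)

lemma unrank:
  assumes "0 \<le> i" "i \<le> int top_rank" shows "unrank i \<in> I" "int (rank I (unrank i)) = i"
proof -
  have "card I > 0" using in_interval(1) fin by (auto simp: card_gt_0_iff)
  then have i: "nat i \<in> {..<card I}" using assms unfolding top_rank_def by (simp add: nat_less_iff)
  show "unrank i \<in> I" unfolding unrank_def
    using bij_betwE[OF bij_betw_inv_into[OF bij_betw_rank[OF fin]]] i by blast
  show "int (rank I (unrank i)) = i" unfolding unrank_def
    using bij_betw_inv_into_right[OF bij_betw_rank[OF fin] i] assms by simp
qed

lemma unrank_mono:
  assumes "0 \<le> i" "i \<le> j" "j \<le> int top_rank" shows "unrank i \<le> unrank j"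
proof (rule ccontr)
  assume "\<not> ?thesis"
  then have "unrank j < unrank i" by simp
  then have "rank I (unrank j) < rank I (unrank i)"
    using unrank(1)[of j] assms by (intro rank_less[OF fin]) auto
  then show False using unrank(2)[of i] unrank(2)[of j] assms by linarith
qed

text \<open>The chain unrolled over all turns: for finite \<open>I\<close> the glued line is a copy
  of the integers, with turns of length \<open>top_rank\<close>.\<close>

definition rank_ext :: "nat \<Rightarrow> (nat \<Rightarrow> 'a) \<Rightarrow> int \<Rightarrow> int" where
  "rank_ext n \<beta> = period_ext n (int top_rank) (\<lambda>k. int (rank I (\<beta> k)))"

lemma rank_ext_shift_mult: "rank_ext n \<beta> (x + k * (int n + 1)) = rank_ext n \<beta> x + k * int top_rank"
  by (rule periodic_shift) (simp add: rank_ext_def period_ext_shift)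

lemma rank_ext_mono:
  assumes "\<beta> \<in> point_obj I b t n" "x \<le> y" shows "rank_ext n \<beta> x \<le> rank_ext n \<beta> y"
proof -
  have "\<beta> n \<le> t" using assms(1) in_interval(5) by (intro in_interval point_obj_in) auto
  then have "rank I (\<beta> n) \<le> top_rank" using rank_le[OF fin] by (metis rank_t)
  moreover have "mono_on {0..n} (\<lambda>k. int (rank I (\<beta> k)))"
    using point_obj_mono[OF assms(1)] by (auto simp: mono_on_def intro!: rank_le[OF fin])
  ultimately have "mono (rank_ext n \<beta>)"
    unfolding rank_ext_def by (intro mono_period_ext) auto
  then show ?thesis using assms(2) by (simp add: monoD)
qed

lemma rank_ext_of_nat:
  assumes "\<beta> \<in> point_obj I b t n" "k \<le> n + 1"
  shows "rank_ext n \<beta> (int k) = int (rank I (\<beta> k))"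
proof (cases "k \<le> n")
  case True
  then show ?thesis by (simp add: rank_ext_def period_ext_of_nat)
next
  case False
  then have k: "k = n + 1" using assms(2) by simp
  have "rank_ext n \<beta> (0 + 1 * (int n + 1)) = rank_ext n \<beta> (int 0) + 1 * int top_rank"
    unfolding rank_ext_shift_mult by simp
  moreover have "rank_ext n \<beta> (int 0) = int (rank I (\<beta> 0))"
    unfolding rank_ext_def by (intro period_ext_of_nat) simp
  ultimately show ?thesis using point_obj_ends[OF assms(1)] rank_b rank_t by (simp add: k add.commute)
qed

text \<open>The unrolled chain is read along the dual map and translated so that its first entry has
  rank 0, that is, equals \<open>b\<close>.\<close>

definition pull :: "nat \<Rightarrow> nat \<Rightarrow> (int \<Rightarrow> int) \<Rightarrow> (nat \<Rightarrow> 'a) \<Rightarrow> nat \<Rightarrow> 'a" where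
  "pull n m f \<beta> =
    (\<lambda>j\<in>{0..m + 1}. unrank (rank_ext n \<beta> (lower_adj f (int j)) - rank_ext n \<beta> (lower_adj f 0)))"

text \<open>Over \<open>m + 1\<close> steps the dual map makes a full turn and the unrolled chain
  gains exactly \<open>top_rank\<close>; monotonicity bounds the values in between, so they can be
  unranked.\<close>

lemma pull_range:
  assumes f: "f \<in> Lambda_lift n m" and \<beta>: "\<beta> \<in> point_obj I b t n" and x: "0 \<le> x" "x \<le> int m + 1"
  shows "0 \<le> rank_ext n \<beta> (lower_adj f x) - rank_ext n \<beta> (lower_adj f 0)"
    "rank_ext n \<beta> (lower_adj f x) - rank_ext n \<beta> (lower_adj f 0) \<le> int top_rank"
    "rank_ext n \<beta> (lower_adj f (int m + 1)) - rank_ext n \<beta> (lower_adj f 0) = int top_rank"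
proof -
  have c: "lower_adj f \<in> Lambda_lift m n" using lower_adj[OF f] by simp
  show "rank_ext n \<beta> (lower_adj f (int m + 1)) - rank_ext n \<beta> (lower_adj f 0) = int top_rank"
    using Lambda_lift_shift[OF c, of 0] rank_ext_shift_mult[of n \<beta> "lower_adj f 0" 1] by simp
  then show "0 \<le> rank_ext n \<beta> (lower_adj f x) - rank_ext n \<beta> (lower_adj f 0)"
    "rank_ext n \<beta> (lower_adj f x) - rank_ext n \<beta> (lower_adj f 0) \<le> int top_rank"
    using rank_ext_mono[OF \<beta> Lambda_lift_mono[OF c x(1)]]
      rank_ext_mono[OF \<beta> Lambda_lift_mono[OF c x(2)]] by linarith+
qed

lemma pull_in:
  assumes f: "f \<in> Lambda_lift n m" and \<beta>: "\<beta> \<in> point_obj I b t n"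
  shows "pull n m f \<beta> \<in> point_obj I b t m"
proof -
  let ?v = "\<lambda>x. rank_ext n \<beta> (lower_adj f x) - rank_ext n \<beta> (lower_adj f 0)"
  have c: "lower_adj f \<in> Lambda_lift m n" using lower_adj[OF f] by simp
  have "unrank (?v (int j)) \<in> I" if "j \<le> m + 1" for j
    using that by (intro unrank pull_range[OF f \<beta>]) auto
  moreover have "unrank (?v (int i)) \<le> unrank (?v (int j))" if "i \<le> j" "j \<le> m + 1" for i j
    using that rank_ext_mono[OF \<beta> Lambda_lift_mono[OF c, of "int i" "int j"]]
    by (intro unrank_mono pull_range[OF f \<beta>]) auto
  moreover have "unrank 0 = b" using unrank_rank[OF in_interval(1)] by (simp add: rank_b)
  moreover have "unrank (?v (int (m + 1))) = t"
    using unrank_rank[OF in_interval(2)] pull_range(3)[OF f \<beta>, of 0] by (simp add: rank_t add.commute)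
  ultimately show ?thesis
    by (auto simp: point_obj_def pull_def mono_on_def)
qed

text \<open>Both sides gain \<open>top_rank\<close> per period, so comparing one period suffices.
  The result makes unrolling compatible with dual maps up to a constant.\<close>

lemma rank_ext_pull:
  assumes f: "f \<in> Lambda_lift n m" and \<beta>: "\<beta> \<in> point_obj I b t n"
  shows "rank_ext m (pull n m f \<beta>) x = rank_ext n \<beta> (lower_adj f x) - rank_ext n \<beta> (lower_adj f 0)"
proof -
  let ?v = "\<lambda>x. rank_ext n \<beta> (lower_adj f x) - rank_ext n \<beta> (lower_adj f 0)"
  have c: "lower_adj f \<in> Lambda_lift m n" using lower_adj[OF f] by simp
  have "rank_ext m (pull n m f \<beta>) = ?v"
  proof (rule periodic_eqI[where m = m and p = "int top_rank"])
    show "rank_ext m (pull n m f \<beta>) (y + int m + 1) = rank_ext m (pull n m f \<beta>) y + int top_rank" for y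
      by (simp add: rank_ext_def period_ext_shift)
    show "?v (y + int m + 1) = ?v y + int top_rank" for y
      using rank_ext_shift_mult[of n \<beta> "lower_adj f y" 1] by (simp add: Lambda_lift_shift[OF c])
    show "rank_ext m (pull n m f \<beta>) (int k) = ?v (int k)" if "k \<le> m" for k
      using that unrank(2)[OF pull_range(1,2)[OF f \<beta>, of "int k"]]
        rank_ext_of_nat[OF pull_in[OF f \<beta>], of k] by (simp add: pull_def)
  qed
  then show ?thesis by (rule fun_cong)
qed

text \<open>The constant subtracted at the first stage cancels in the differences taken at the
  second.\<close>

lemma pull_comp:
  assumes f: "f \<in> Lambda_lift n m" and g: "g \<in> Lambda_lift m p" and \<beta>: "\<beta> \<in> point_obj I b t n"
  shows "pull n p (g \<circ> f) \<beta> = pull m p g (pull n m f \<beta>)"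
  by (simp add: pull_def[of n p] pull_def[of m p] rank_ext_pull[OF f \<beta>] lower_adj_comp[OF f g])

lemma pull_id:
  assumes \<beta>: "\<beta> \<in> point_obj I b t n" shows "pull n n id \<beta> = \<beta>"
proof (rule point_obj_eqI[OF pull_in[OF Lambda_lift_id \<beta>] \<beta>])
  fix j assume "j \<le> n + 1"
  then show "pull n n id \<beta> j = \<beta> j"
    using rank_ext_of_nat[OF \<beta>, of 0] point_obj_ends[OF \<beta>]
    by (simp add: pull_def lower_adj_eqI[OF galois_id] rank_ext_of_nat[OF \<beta>] rank_b unrank_rank
        point_obj_in[OF \<beta>])
qed

text \<open>Another representative shifts the dual map by full turns, which adds a constant to the
  unrolled chain; differences do not see it.\<close>

lemma pull_class:
  assumes f: "f \<in> Lambda_lift n m" and g: "g \<in> Lambda_class n m f"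
  shows "pull n m g = pull n m f"
proof -
  have c: "lower_adj f \<in> Lambda_lift m n" "galois (lower_adj f) f" using lower_adj[OF f] by auto
  obtain k where k: "g = (\<lambda>x. f x + k * (int m + 1))"
    using g Lambda_class_iff[OF f] by blast
  have "lower_adj g x = lower_adj f x + (- k) * (int n + 1)" for x
    using lower_adj_eqI[OF galois_add[OF c(2), of "k * (int m + 1)"]]
      Lambda_lift_shift_mult[OF c(1), of x "- k"] by (simp add: k)
  then have "rank_ext n \<beta> (lower_adj g x) = rank_ext n \<beta> (lower_adj f x) + (- k) * int top_rank" for \<beta> x
    by (simp only: rank_ext_shift_mult)
  then show ?thesis by (simp add: pull_def fun_eq_iff)
qed

text \<open>The dual map of a simplicial arrow fixes 0, where the unrolled chain is 0, so only
  reindexing remains.\<close>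

lemma pull_Delta:
  assumes f: "f \<in> Delta_hom n m" and \<beta>: "\<beta> \<in> point_obj I b t n"
  shows "pull n m (Delta_lift n m f) \<beta> = (\<lambda>j\<in>{0..m + 1}. \<beta> (upper_star n f j))"
  unfolding pull_def
proof (rule restrict_ext)
  fix j assume "j \<in> {0..m + 1}"
  then show "unrank (rank_ext n \<beta> (lower_adj (Delta_lift n m f) (int j)) -
      rank_ext n \<beta> (lower_adj (Delta_lift n m f) 0)) = \<beta> (upper_star n f j)"
    using rank_ext_of_nat[OF \<beta>, of 0] rank_ext_of_nat[OF \<beta> upper_star_le[of n f j]]
      point_obj_ends[OF \<beta>] point_obj_in[OF \<beta> upper_star_le[of n f j]]
    by (simp add: lower_adj_Delta_lift_0[OF f] lower_adj_Delta_lift_of_nat[OF f] rank_b unrank_rank)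
qed

text \<open>The choice of representative is harmless by \<open>pull_class\<close>; the restrictions
  provide the required extensionality.\<close>

definition cyclic_functor :: "((int \<Rightarrow> int) set, nat \<Rightarrow> 'a) set_functor" where
  "cyclic_functor =
    \<lparr>Fobj = point_obj I b t,
     Fmap = (\<lambda>n m. \<lambda>\<phi>\<in>Lambda_hom n m. \<lambda>\<beta>\<in>point_obj I b t n. pull n m (SOME f. f \<in> \<phi>) \<beta>)\<rparr>"

lemma Fmap_cyclic_functor:
  assumes f: "f \<in> Lambda_lift n m"
  shows "Fmap cyclic_functor n m (Lambda_class n m f) = (\<lambda>\<beta>\<in>point_obj I b t n. pull n m f \<beta>)"
proof -
  have "f \<in> Lambda_class n m f" using equiv_class_self[OF equiv_Lambda_rel f] .
  then have "(SOME g. g \<in> Lambda_class n m f) \<in> Lambda_class n m f"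
    by (rule someI[of "\<lambda>g. g \<in> Lambda_class n m f"])
  then show ?thesis
    using Lambda_class_in_hom[OF f] pull_class[OF f] by (simp add: cyclic_functor_def)
qed

lemma cyclic_structure_cyclic_functor: "cyclic_structure I b t cyclic_functor"
  unfolding cyclic_structure_def
proof
  have obj: "Fobj cyclic_functor = point_obj I b t" by (simp add: cyclic_functor_def)
  show "Lambda_functor cyclic_functor"
    unfolding Lambda_functor_def obj
  proof (intro conjI allI ballI)
    fix n m
    show "Fmap cyclic_functor n m \<in> Lambda_hom n m \<rightarrow>\<^sub>E (point_obj I b t n \<rightarrow>\<^sub>E point_obj I b t m)"
    proof (rule PiE_I)
      fix \<phi> assume "\<phi> \<in> Lambda_hom n m"
      then obtain f where "f \<in> Lambda_lift n m" "\<phi> = Lambda_class n m f" by (rule Lambda_hom_cases)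
      then show "Fmap cyclic_functor n m \<phi> \<in> point_obj I b t n \<rightarrow>\<^sub>E point_obj I b t m"
        using pull_in by (auto simp: Fmap_cyclic_functor)
    qed (simp add: cyclic_functor_def)
  next
    fix n
    show "Fmap cyclic_functor n n (Lambda_id n) = (\<lambda>\<beta>\<in>point_obj I b t n. \<beta>)"
      unfolding Lambda_id_def Fmap_cyclic_functor[OF Lambda_lift_id]
      by (rule restrict_ext) (rule pull_id)
  next
    fix n m p \<phi> \<psi> assume "\<phi> \<in> Lambda_hom n m" "\<psi> \<in> Lambda_hom m p"
    then obtain f g where f: "f \<in> Lambda_lift n m" "\<phi> = Lambda_class n m f"
      and g: "g \<in> Lambda_lift m p" "\<psi> = Lambda_class m p g" by (metis Lambda_hom_cases)
    show "Fmap cyclic_functor n p (Lambda_comp \<psi> \<phi>) =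
        compose (point_obj I b t n) (Fmap cyclic_functor m p \<psi>) (Fmap cyclic_functor n m \<phi>)"
      unfolding f(2) g(2) Lambda_comp_class[OF f(1) g(1)] Fmap_cyclic_functor[OF f(1)]
        Fmap_cyclic_functor[OF g(1)] Fmap_cyclic_functor[OF Lambda_lift_comp[OF f(1) g(1)]] compose_def
      by (rule restrict_ext) (simp add: pull_comp[OF f(1) g(1)] pull_in[OF f(1)])
  qed
  have "Fmap cyclic_functor n m (j_map n m f) =
      (\<lambda>\<beta>\<in>point_obj I b t n. \<lambda>j\<in>{0..m + 1}. \<beta> (upper_star n f j))" if f: "f \<in> Delta_hom n m" for n m f
    unfolding j_map_eq Fmap_cyclic_functor[OF Delta_lift[OF f]]
    by (rule restrict_ext) (rule pull_Delta[OF f])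
  then show "precomp_j cyclic_functor = point_functor I b t"
    unfolding precomp_j_def point_functor_def obj by (auto simp: fun_eq_iff restrict_def)
qed

end

theorem corollary5p2:
  shows "(\<forall>(I :: 'a::linorder set) b t. order_interval I b t \<longrightarrow>
            (\<exists>F. cyclic_structure I b t F) \<longrightarrow> homogeneous_order (glued_line I b t) glued_le)
       \<and> (\<exists>(I :: real set) b t. order_interval I b t \<and> \<not> (\<exists>F. cyclic_structure I b t F))
       \<and> (\<forall>(I :: 'a::linorder set) b t. order_interval I b t \<longrightarrow> finite I \<longrightarrow>
            (\<exists>!F. cyclic_structure I b t F))"
proof (intro conjI allI impI)
  fix I :: "'a set" and b t
  assume I: "order_interval I b t" and "\<exists>F. cyclic_structure I b t F"
  then show "homogeneous_order (glued_line I b t) glued_le"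
    using cyclic_point.homogeneous_glued_line[OF cyclic_point.intro[OF I]] by blast
next
  fix I :: "'a set" and b t
  assume I: "order_interval I b t" and fin: "finite I"
  show "\<exists>!F. cyclic_structure I b t F"
    using finite_interval.cyclic_structure_cyclic_functor[OF finite_interval.intro[OF I fin]]
      cyclic_structure_unique[OF I fin] by blast
next
  have "order_interval (insert 0 {1..2} :: real set) 0 2" by (auto simp: order_interval_def)
  then show "\<exists>(I :: real set) b t. order_interval I b t \<and> \<not> (\<exists>F. cyclic_structure I b t F)"
    using no_cyclic_structure_with_gap by blast
qed

end
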